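(* Let $\varphi$ be an Orlicz function and let $\omega:[0,\infty)\to[0,\infty)$ be a weight function that is not identically zero. Then the Orlicz-Lorentz space $\Lambda^\circ_{\varphi,\omega}[0,\infty)$ (endowed with the Orlicz norm) is non-square if and only if $\int_0^\infty \omega(t)\,dt=\infty$.
   Context: Orlicz function: $\varphi:\mathbb{R}\to[0,\infty)$ is convex, even, $\varphi(0)=0$, $\varphi(u)>0$ for all $u>0$, $\lim_{u\to0}\varphi(u)/u=0$ and $\lim_{u\to\infty}\varphi(u)/u=\infty$. Its complementary function is $\psi(v)=\sup_{u>0}\{|uv|-\varphi(u)\}$, $v\in\mathbb{R}$ (again an Orlicz function). Rearrangements: let $\gamma=\infty$ and let $\mu$ be Lebesgue measure. For measurable $x:[0,\gamma)\to\mathbb{R}$, put $d_x(\theta)=\mu\{s\in[0,\gamma):|x(s)|>\theta\}$ and $x^\ast(t)=\inf\{\theta>0:d_x(\theta)\le t\}$, $t\ge0$. Weight function: $\omega:[0,\gamma)\to[0,\infty)$ that is non-increasing and locally integrable (so integrable near $0$). Put $\rho_{\varphi,\omega}(x)=\int_0^\gamma\varphi(x^\ast(t))\omega(t)\,dt$, and similarly $\rho_{\psi,\omega}$. The Orlicz-Lorentz space $\Lambda_{\varphi,\omega}[0,\gamma)$ is the set of (classes of a.e. equal) measurable functions $x$ on $[0,\gamma)$ with $\rho_{\varphi,\omega}(\lambda x)<\infty$ for some $\lambda>0$. The Orlicz norm is $$\|x\|^\circ_{\varphi,\omega}=\sup_{\rho_{\psi,\omega}(y)\le1}\int_0^\gamma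 x^\ast(t)y^\ast(t)\omega(t)\,dt=\inf_{k>0}\frac1k\bigl(1+\rho_{\varphi,\omega}(kx)\bigr),$$ the supremum being over measurable $y$ on $[0,\gamma)$ (the second equality is known). $\Lambda^\circ_{\varphi,\omega}[0,\gamma)$ denotes $\Lambda_{\varphi,\omega}[0,\gamma)$ with this norm; it is a Banach space. A Banach space $X$ with unit sphere $S(X)$ is non-square if $\min\{\|\frac{x-y}{2}\|,\|\frac{x+y}{2}\|\}<1$ for all $x,y\in S(X)$. *)

theory Defs
  imports "HOL-Analysis.Analysis"
begin

definition orlicz_function :: "(real \<Rightarrow> real) \<Rightarrow> bool" where
  "orlicz_function \<phi> \<longleftrightarrow>
     (\<forall>u. 0 \<le> \<phi> u) \<and> convex_on UNIV \<phi> \<and> (\<forall>u. \<phi> (- u) = \<phi> u) \<and>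
     \<phi> 0 = 0 \<and> (\<forall>u>0. 0 < \<phi> u) \<and>
     ((\<lambda>u. \<phi> u / u) \<longlongrightarrow> 0) (at 0) \<and>
     filterlim (\<lambda>u. \<phi> u / u) at_top at_top"

(* For an Orlicz function the superlinear growth of phi makes this set bounded above,
   so the real supremum is the true one. *)
definition complementary :: "(real \<Rightarrow> real) \<Rightarrow> real \<Rightarrow> real" where
  "complementary \<phi> v = (SUP u\<in>{0<..}. \<bar>u * v\<bar> - \<phi> u)"

definition distribution_fun :: "(real \<Rightarrow> real) \<Rightarrow> real \<Rightarrow> ennreal" where
  "distribution_fun x \<theta> = emeasure lebesgue {s\<in>{0..}. \<bar>x s\<bar> > \<theta>}"

(* Extended-valued: the infimum of the empty set is infinity. *)
definition rearrangement :: "(real \<Rightarrow> real) \<Rightarrow> real \<Rightarrow> ennreal" where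
  "rearrangement x t =
     (INF \<theta>\<in>{\<theta>. 0 < \<theta> \<and> distribution_fun x \<theta> \<le> ennreal t}. ennreal \<theta>)"

(* Monotonicity is required on the open half line only, so that weights unbounded near 0
   such as t powr (-1/2) are covered; a real-valued function that is non-increasing on
   all of {0..} is bounded.  The single value at 0 plays no role in any integral below. *)
definition weight_function :: "(real \<Rightarrow> real) \<Rightarrow> bool" where
  "weight_function \<omega> \<longleftrightarrow>
     (\<forall>t\<ge>0. 0 \<le> \<omega> t) \<and> antimono_on {0<..} \<omega> \<and>
     (\<forall>a>0. \<omega> absolutely_integrable_on {0..a})"

(* An Orlicz function applied to an extended rearrangement value, with value infinity
   at infinity. *)
definition orlicz_ext :: "(real \<Rightarrow> real) \<Rightarrow> ennreal \<Rightarrow> ennreal" where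
  "orlicz_ext \<phi> u = (if u = \<infinity> then \<infinity> else ennreal (\<phi> (enn2real u)))"

definition modular :: "(real \<Rightarrow> real) \<Rightarrow> (real \<Rightarrow> real) \<Rightarrow> (real \<Rightarrow> real) \<Rightarrow> ennreal" where
  "modular \<phi> \<omega> x =
     (\<integral>\<^sup>+t\<in>{0..}. orlicz_ext \<phi> (rearrangement x t) * ennreal (\<omega> t) \<partial>lebesgue)"

(* Elements are representatives of the classes of a.e. equal functions; by
   rearrangement_cong_AE below, the modular and the norm depend only on the class. *)
definition orlicz_lorentz_space :: "(real \<Rightarrow> real) \<Rightarrow> (real \<Rightarrow> real) \<Rightarrow> (real \<Rightarrow> real) set" where
  "orlicz_lorentz_space \<phi> \<omega> =
     {x \<in> borel_measurable (lebesgue_on {0..}).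
        \<exists>c>0. modular \<phi> \<omega> (\<lambda>s. c * x s) < \<infinity>}"

definition orlicz_norm :: "(real \<Rightarrow> real) \<Rightarrow> (real \<Rightarrow> real) \<Rightarrow> (real \<Rightarrow> real) \<Rightarrow> ennreal" where
  "orlicz_norm \<phi> \<omega> x =
     (SUP y\<in>{y \<in> borel_measurable (lebesgue_on {0..}). modular (complementary \<phi>) \<omega> y \<le> 1}.
        \<integral>\<^sup>+t\<in>{0..}. rearrangement x t * rearrangement y t * ennreal (\<omega> t) \<partial>lebesgue)"

(* X is a linear space of real functions (with pointwise operations) and N its norm. *)
definition non_square :: "('a \<Rightarrow> real) set \<Rightarrow> (('a \<Rightarrow> real) \<Rightarrow> ennreal) \<Rightarrow> bool" where
  "non_square X N \<longleftrightarrow>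
     (\<forall>x\<in>{x\<in>X. N x = 1}. \<forall>y\<in>{y\<in>X. N y = 1}.
        min (N (\<lambda>s. (x s - y s) / 2)) (N (\<lambda>s. (x s + y s) / 2)) < 1)"

lemma rearrangement_cong_AE:
  assumes "x \<in> borel_measurable (lebesgue_on {0..})"
    and "y \<in> borel_measurable (lebesgue_on {0..})"
    and eq: "AE s in lebesgue_on {0..}. x s = y s"
  shows "rearrangement x = rearrangement y"
proof -
  have meas: "{s\<in>{0..}. \<bar>z s\<bar> > \<theta>} \<in> sets lebesgue"
    if z: "z \<in> borel_measurable (lebesgue_on {0..})" for z :: "real \<Rightarrow> real" and \<theta>
  proof -
    have "{s \<in> space (lebesgue_on {0..}). \<bar>z s\<bar> > \<theta>} \<in> sets (lebesgue_on {0..})"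
      using z by measurable
    then show ?thesis
      by (simp add: sets_restrict_space_iff space_restrict_space)
  qed
  have "AE s in lebesgue. s \<in> {0..} \<longrightarrow> x s = y s"
    using eq by (simp add: AE_restrict_space_iff)
  then have "distribution_fun x \<theta> = distribution_fun y \<theta>" for \<theta>
    unfolding distribution_fun_def
    by (intro emeasure_eq_AE meas assms) (auto elim!: eventually_mono)
  then show ?thesis
    by (simp add: rearrangement_def fun_eq_iff)
qed

end

theory Submission
  imports Defs
begin

text \<open>Suppose the weight has infinite integral. By approximation with bounded functions of bounded
  support, a function \<open>x\<close> of norm 1 has a multiplier \<open>k > 0\<close> with
  \<open>1 + \<rho>(k x) \<le> k\<close>; let \<open>l\<close> be a multiplier for \<open>y\<close>, and put
  \<open>a = l / (k + l)\<close>, \<open>b = k / (k + l)\<close>, \<open>c = 2 k l / (k + l)\<close>. Then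
  \<open>c (x \<plusminus> y) / 2 = a k x \<plusminus> b l y\<close>, so by convexity of \<open>\<phi>\<close> and subadditivity of
  \<open>h \<mapsto> \<integral> h* \<omega>\<close> both midpoints have norm at most 1. If both norms were 1, strict
  monotonicity of that functional (here the infinite weight enters) would give
  \<open>\<phi>(a k x \<plusminus> b l y) = a \<phi>(k x) + b \<phi>(l y)\<close> a.e. for both signs. But the smaller of the
  two left-hand sides is strictly below the right-hand side unless \<open>x = y = 0\<close>, because
  \<open>\<phi>(a u) < a \<phi>(u)\<close> for \<open>0 < a < 1\<close>, \<open>u > 0\<close>.

  If the weight has finite integral, a positive constant \<open>x\<close> has finite norm, and multiplying it by
  \<open>\<plusminus>1\<close> alternately on unit intervals gives \<open>y\<close> such that \<open>x\<close>, \<open>y\<close> and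
  both midpoints have the same constant rearrangement.\<close>

section \<open>Distribution function and rearrangement\<close>

lemma borel_measurable_antimono_ennreal:
  fixes f :: "real \<Rightarrow> ennreal"
  assumes "antimono f"
  shows "f \<in> borel_measurable borel"
proof (rule borel_measurableI_greater)
  fix y
  have "is_interval {x. y < f x}"
    using assms unfolding is_interval_1 monotone_def
    by (metis (mono_tags, lifting) less_le_trans mem_Collect_eq)
  then show "{x \<in> space borel. y < f x} \<in> sets borel"
    using real_interval_borel_measurable by simp
qed

text \<open>An extended value is determined by its finite upper bounds. With
  \<open>rearrangement_le_iff\<close> this turns identities between rearrangements into identities
  between level sets.\<close>

lemma ennreal_eqI_le:
  fixes a b :: ennreal
  assumes "\<And>\<theta>. 0 \<le> \<theta> \<Longrightarrow> a \<le> ennreal \<theta> \<longleftrightarrow> b \<le> ennreal \<theta>"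
  shows "a = b"
proof (rule antisym)
  show "a \<le> b"
    using assms by (cases b) auto
  show "b \<le> a"
    using assms by (cases a) auto
qed

lemma emeasure_lebesgue_borel:
  "A \<in> sets borel \<Longrightarrow> emeasure lebesgue A = emeasure lborel A"
  by (simp add: main_part_sets)

lemma distribution_fun_borel:
  assumes [measurable]: "x \<in> borel_measurable borel"
  shows "distribution_fun x \<theta> = emeasure lborel {s. 0 \<le> s \<and> \<theta> < \<bar>x s\<bar>}"
proof -
  have "{s\<in>{0..}. \<bar>x s\<bar> > \<theta>} = {s. 0 \<le> s \<and> \<theta> < \<bar>x s\<bar>}" by auto
  moreover have "{s. 0 \<le> s \<and> \<theta> < \<bar>x s\<bar>} \<in> sets borel" by measurable
  ultimately show ?thesis
    unfolding distribution_fun_def by (metis emeasure_lebesgue_borel)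
qed

lemma distribution_fun_antimono:
  assumes [measurable]: "x \<in> borel_measurable borel" and "\<theta> \<le> \<theta>'"
  shows "distribution_fun x \<theta>' \<le> distribution_fun x \<theta>"
  unfolding distribution_fun_borel[OF assms(1)]
  by (rule emeasure_mono) (use assms(2) in auto)

text \<open>Continuity of the measure from below: the level set at \<theta> is the increasing union
  of the level sets at \<theta> + 1/(n+1).\<close>

lemma distribution_fun_right_cont:
  assumes [measurable]: "x \<in> borel_measurable borel"
    and le: "\<And>\<theta>'. \<theta> < \<theta>' \<Longrightarrow> distribution_fun x \<theta>' \<le> c"
  shows "distribution_fun x \<theta> \<le> c"
proof -
  define A where "A n = {s. 0 \<le> s \<and> \<theta> + 1 / real (Suc n) < \<bar>x s\<bar>}" for n
  have "(\<Union>n. A n) = {s. 0 \<le> s \<and> \<theta> < \<bar>x s\<bar>}"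
  proof (intro equalityI subsetI)
    fix s assume s: "s \<in> {s. 0 \<le> s \<and> \<theta> < \<bar>x s\<bar>}"
    then have "0 < \<bar>x s\<bar> - \<theta>" by simp
    then obtain n where "inverse (real (Suc n)) < \<bar>x s\<bar> - \<theta>"
      using reals_Archimedean by blast
    with s show "s \<in> (\<Union>n. A n)"
      by (auto simp: A_def inverse_eq_divide intro!: exI[of _ n])
  next
    fix s assume "s \<in> (\<Union>n. A n)"
    then obtain n where "0 \<le> s" "\<theta> + 1 / real (Suc n) < \<bar>x s\<bar>"
      by (auto simp: A_def)
    then show "s \<in> {s. 0 \<le> s \<and> \<theta> < \<bar>x s\<bar>}"
      by (smt (verit) mem_Collect_eq of_nat_0_less_iff zero_less_Suc zero_less_divide_1_iff)
  qed
  moreover have "(SUP n. emeasure lborel (A n)) = emeasure lborel (\<Union>n. A n)"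
  proof (rule SUP_emeasure_incseq)
    show "range A \<subseteq> sets lborel" by (auto simp: A_def)
    show "incseq A"
    proof (rule incseq_SucI)
      fix n
      have "1 / real (Suc (Suc n)) \<le> 1 / real (Suc n)" by (simp add: field_simps)
      then show "A n \<le> A (Suc n)" by (auto simp: A_def)
    qed
  qed
  moreover have "emeasure lborel (A n) \<le> c" for n
    using le[of "\<theta> + 1 / real (Suc n)"] by (simp add: distribution_fun_borel A_def)
  then have "(SUP n. emeasure lborel (A n)) \<le> c"
    by (intro SUP_least)
  ultimately show ?thesis
    unfolding distribution_fun_borel[OF assms(1)] by simp
qed

text \<open>The infimum defining the rearrangement is attained because the distribution function is
  right-continuous. This also covers \<theta> = 0, although the infimum runs over positive numbers
  only.\<close>

lemma rearrangement_le_iff: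
  assumes x: "x \<in> borel_measurable borel" and \<theta>: "0 \<le> \<theta>"
  shows "rearrangement x t \<le> ennreal \<theta> \<longleftrightarrow> distribution_fun x \<theta> \<le> ennreal t"
proof
  assume le: "rearrangement x t \<le> ennreal \<theta>"
  show "distribution_fun x \<theta> \<le> ennreal t"
  proof (rule distribution_fun_right_cont[OF x])
    fix \<theta>' assume "\<theta> < \<theta>'"
    then have "rearrangement x t < ennreal \<theta>'"
      using le \<theta> ennreal_less_iff le_less_trans by blast
    then obtain \<theta>'' where "0 < \<theta>''" "distribution_fun x \<theta>'' \<le> ennreal t" "ennreal \<theta>'' < ennreal \<theta>'"
      unfolding rearrangement_def INF_less_iff by auto
    moreover from this have "\<theta>'' \<le> \<theta>'" by (simp add: ennreal_less_iff)
    ultimately show "distribution_fun x \<theta>' \<le> ennreal t"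
      using distribution_fun_antimono[OF x] order_trans by blast
  qed
next
  assume le: "distribution_fun x \<theta> \<le> ennreal t"
  show "rearrangement x t \<le> ennreal \<theta>"
  proof (rule ennreal_le_epsilon)
    fix e :: real assume "0 < e"
    have "rearrangement x t \<le> ennreal (\<theta> + e)"
      unfolding rearrangement_def
      using distribution_fun_antimono[OF x, of \<theta> "\<theta> + e"] le \<theta> \<open>0 < e\<close>
      by (intro INF_lower) auto
    then show "rearrangement x t \<le> ennreal \<theta> + ennreal e"
      using \<theta> \<open>0 < e\<close> by simp
  qed
qed

lemma antimono_rearrangement: "antimono (rearrangement x)"
proof (rule antimonoI)
  fix s t :: real assume "s \<le> t"
  then have "ennreal s \<le> ennreal t" by (rule ennreal_leI)
  then show "rearrangement x t \<le> rearrangement x s"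
    unfolding rearrangement_def by (intro INF_superset_mono) auto
qed

lemma borel_measurable_rearrangement [measurable]:
  "rearrangement x \<in> borel_measurable borel"
  by (rule borel_measurable_antimono_ennreal[OF antimono_rearrangement])

lemma rearrangement_mono:
  assumes x: "x \<in> borel_measurable borel" and y: "y \<in> borel_measurable borel"
    and le: "\<And>s. 0 \<le> s \<Longrightarrow> \<bar>x s\<bar> \<le> \<bar>y s\<bar>"
  shows "rearrangement x t \<le> rearrangement y t"
proof (cases "rearrangement y t")
  case (real \<theta>)
  note [measurable] = x y
  have "distribution_fun x \<theta> \<le> distribution_fun y \<theta>"
    unfolding distribution_fun_borel[OF x] distribution_fun_borel[OF y]
  proof (rule emeasure_mono)
    show "{s. 0 \<le> s \<and> \<theta> < \<bar>x s\<bar>} \<subseteq> {s. 0 \<le> s \<and> \<theta> < \<bar>y s\<bar>}"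
      using le by fastforce
  qed measurable
  moreover have "distribution_fun y \<theta> \<le> ennreal t"
    using rearrangement_le_iff[OF y, of \<theta> t] real by simp
  ultimately show ?thesis
    using rearrangement_le_iff[OF x, of \<theta> t] real by simp
qed simp

lemma rearrangement_cmult:
  assumes x: "x \<in> borel_measurable borel" and c: "0 < c"
  shows "rearrangement (\<lambda>s. c * x s) t = ennreal c * rearrangement x t"
proof (rule ennreal_eqI_le)
  fix \<theta> :: real assume \<theta>: "0 \<le> \<theta>"
  have cx: "(\<lambda>s. c * x s) \<in> borel_measurable borel" using x by measurable
  have eq: "{s. 0 \<le> s \<and> \<theta> < \<bar>c * x s\<bar>} = {s. 0 \<le> s \<and> \<theta> / c < \<bar>x s\<bar>}"
    using c by (auto simp: field_simps abs_mult)
  have "rearrangement (\<lambda>s. c * x s) t \<le> ennreal \<theta> \<longleftrightarrow> rearrangement x t \<le> ennreal (\<theta> / c)"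
    using rearrangement_le_iff[OF cx \<theta>] rearrangement_le_iff[OF x, of "\<theta> / c"] \<theta> c
    by (simp add: distribution_fun_borel[OF x] distribution_fun_borel[OF cx] eq)
  also have "\<dots> \<longleftrightarrow> ennreal c * rearrangement x t \<le> ennreal \<theta>"
    using c \<theta> by (cases "rearrangement x t")
      (auto simp: ennreal_mult[symmetric] field_simps ennreal_mult_top top_unique)
  finally show "rearrangement (\<lambda>s. c * x s) t \<le> ennreal \<theta> \<longleftrightarrow> ennreal c * rearrangement x t \<le> ennreal \<theta>" .
qed

text \<open>The excess over l has at height \<theta> the level set that x has at height \<theta> +
  l. Truncated subtraction in \<open>ennreal\<close> matches the maximum with 0.\<close>

lemma rearrangement_excess:
  assumes x: "x \<in> borel_measurable borel" and l: "0 \<le> l"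
  shows "rearrangement (\<lambda>s. max 0 (\<bar>x s\<bar> - l)) t = rearrangement x t - ennreal l"
proof (rule ennreal_eqI_le)
  fix \<theta> :: real assume \<theta>: "0 \<le> \<theta>"
  have lx: "(\<lambda>s. max 0 (\<bar>x s\<bar> - l)) \<in> borel_measurable borel" using x by measurable
  have eq: "{s. 0 \<le> s \<and> \<theta> < \<bar>max 0 (\<bar>x s\<bar> - l)\<bar>} = {s. 0 \<le> s \<and> \<theta> + l < \<bar>x s\<bar>}"
    using \<theta> by auto
  have "rearrangement (\<lambda>s. max 0 (\<bar>x s\<bar> - l)) t \<le> ennreal \<theta> \<longleftrightarrow> rearrangement x t \<le> ennreal (\<theta> + l)"
    using rearrangement_le_iff[OF lx \<theta>] rearrangement_le_iff[OF x, of "\<theta> + l"] \<theta> l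
    by (simp only: distribution_fun_borel[OF x] distribution_fun_borel[OF lx] eq)
  also have "\<dots> \<longleftrightarrow> rearrangement x t - ennreal l \<le> ennreal \<theta>"
    using l \<theta> by (cases "rearrangement x t") (auto simp: ennreal_minus top_unique simp flip: ennreal_plus)
  finally show "rearrangement (\<lambda>s. max 0 (\<bar>x s\<bar> - l)) t \<le> ennreal \<theta> \<longleftrightarrow> rearrangement x t - ennreal l \<le> ennreal \<theta>" .
qed

section \<open>Layer cake formula and equimeasurability\<close>

lemma emeasure_below_ennreal: "emeasure lborel {\<theta>. 0 \<le> \<theta> \<and> ennreal \<theta> < v} = v"
proof (cases v)
  case (real r)
  then have "{\<theta>. 0 \<le> \<theta> \<and> ennreal \<theta> < v} = {0..<r}"
    by (auto simp: ennreal_less_iff)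
  with real show ?thesis by simp
next
  case top
  then have eq: "{\<theta>. 0 \<le> \<theta> \<and> ennreal \<theta> < v} = {0..}"
    by (auto simp: top.not_eq_extremum[symmetric])
  have "emeasure lborel {0::real..} = top"
  proof (rule ccontr)
    assume "emeasure lborel {0::real..} \<noteq> top"
    then obtain r where r: "0 \<le> r" "emeasure lborel {0::real..} = ennreal r"
      by (metis ennreal_cases)
    have "emeasure lborel {0..r + 1} \<le> emeasure lborel {0::real..}"
      by (intro emeasure_mono) auto
    with r show False by simp
  qed
  with top eq show ?thesis by metis
qed

text \<open>Each value \<open>v t\<close> is the length of the set of \<theta> >= 0 below it;
  exchanging the two integrations then leaves integrals of u over superlevel sets of v.\<close>

lemma nn_integral_layer_cake:
  fixes v :: "real \<Rightarrow> ennreal"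
  assumes [measurable]: "v \<in> borel_measurable borel" "u \<in> borel_measurable borel"
  shows "(\<integral>\<^sup>+t. u t * v t \<partial>lborel) =
    (\<integral>\<^sup>+\<theta>. (\<integral>\<^sup>+t. u t * indicator {t. ennreal \<theta> < v t} t \<partial>lborel) * indicator {0..} \<theta> \<partial>lborel)"
proof -
  have "(\<integral>\<^sup>+t. u t * v t \<partial>lborel) =
      (\<integral>\<^sup>+t. u t * (\<integral>\<^sup>+\<theta>. indicator {\<theta>. 0 \<le> \<theta> \<and> ennreal \<theta> < v t} \<theta> \<partial>lborel) \<partial>lborel)"
    by (simp add: emeasure_below_ennreal)
  also have "\<dots> = (\<integral>\<^sup>+t. (\<integral>\<^sup>+\<theta>. u t * indicator {\<theta>. 0 \<le> \<theta> \<and> ennreal \<theta> < v t} \<theta> \<partial>lborel) \<partial>lborel)"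
    by (simp add: nn_integral_cmult)
  also have "\<dots> = (\<integral>\<^sup>+\<theta>. (\<integral>\<^sup>+t. u t * indicator {\<theta>. 0 \<le> \<theta> \<and> ennreal \<theta> < v t} \<theta> \<partial>lborel) \<partial>lborel)"
    by (rule lborel_pair.Fubini') (simp add: indicator_def)
  also have "\<dots> = (\<integral>\<^sup>+\<theta>. (\<integral>\<^sup>+t. u t * indicator {t. ennreal \<theta> < v t} t * indicator {0..} \<theta> \<partial>lborel) \<partial>lborel)"
    by (intro nn_integral_cong) (auto simp: indicator_def)
  also have "\<dots> = (\<integral>\<^sup>+\<theta>. (\<integral>\<^sup>+t. u t * indicator {t. ennreal \<theta> < v t} t \<partial>lborel) * indicator {0..} \<theta> \<partial>lborel)"
    by (intro nn_integral_cong nn_integral_multc) measurable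
  finally show ?thesis .
qed

text \<open>By the layer cake formula it suffices to compare level sets. By
  \<open>rearrangement_le_iff\<close> the set where the rearrangement exceeds \<theta> is an initial
  interval whose length is the distribution function of x at \<theta>.\<close>

lemma nn_integral_rearrangement:
  assumes x: "x \<in> borel_measurable borel"
  shows "(\<integral>\<^sup>+t. indicator {0..} t * rearrangement x t \<partial>lborel) = (\<integral>\<^sup>+s. indicator {0..} s * ennreal \<bar>x s\<bar> \<partial>lborel)"
proof -
  note [measurable] = x
  have "(\<integral>\<^sup>+t. indicator {0..} t * indicator {t. ennreal \<theta> < rearrangement x t} t \<partial>lborel) =
      (\<integral>\<^sup>+s. indicator {0..} s * indicator {s. ennreal \<theta> < ennreal \<bar>x s\<bar>} s \<partial>lborel)" if "0 \<le> \<theta>" for \<theta>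
  proof -
    have "(\<integral>\<^sup>+t. indicator {0..} t * indicator {t. ennreal \<theta> < rearrangement x t} t \<partial>lborel)
       = (\<integral>\<^sup>+t. indicator {t. 0 \<le> t \<and> ennreal t < distribution_fun x \<theta>} t \<partial>lborel)"
      using rearrangement_le_iff[OF x that]
      by (intro nn_integral_cong) (auto simp: indicator_def simp flip: not_le)
    also have "\<dots> = distribution_fun x \<theta>"
      by (simp add: emeasure_below_ennreal)
    also have "\<dots> = (\<integral>\<^sup>+s. indicator {s. 0 \<le> s \<and> \<theta> < \<bar>x s\<bar>} s \<partial>lborel)"
      by (simp add: distribution_fun_borel)
    also have "\<dots> = (\<integral>\<^sup>+s. indicator {0..} s * indicator {s. ennreal \<theta> < ennreal \<bar>x s\<bar>} s \<partial>lborel)"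
      using that by (intro nn_integral_cong) (auto simp: indicator_def ennreal_less_iff)
    finally show ?thesis .
  qed
  then show ?thesis
    by (subst (1 2) nn_integral_layer_cake) (auto intro!: nn_integral_cong simp: indicator_def)
qed

section \<open>The Lorentz functional\<close>

text \<open>The cut to the open half line leaves only the region where \<omega> is monotone, so the
  density is Borel on the whole line and integrals over \<open>{0..}\<close> become integrals
  against \<open>lborel\<close>.\<close>

definition weight_density :: "(real \<Rightarrow> real) \<Rightarrow> real \<Rightarrow> ennreal" where
  "weight_density \<omega> t = ennreal (\<omega> t) * indicator {0<..} t"

text \<open>The classical Lorentz functional of exponent 1. The modular of x is its value at \<phi>
  composed with x, see \<open>modular_eq_lorentz\<close>.\<close>

definition lorentz :: "(real \<Rightarrow> real) \<Rightarrow> (real \<Rightarrow> real) \<Rightarrow> ennreal" where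
  "lorentz \<omega> h = (\<integral>\<^sup>+t. rearrangement h t * weight_density \<omega> t \<partial>lborel)"

lemma borel_measurable_weight_density:
  assumes "weight_function \<omega>"
  shows "weight_density \<omega> \<in> borel_measurable borel"
proof -
  have "mono_on {0<..} (\<lambda>t. - \<omega> t)"
    using assms by (auto simp: weight_function_def monotone_on_def)
  from borel_measurable_uminus[OF borel_measurable_mono_on_fnc[OF this]]
  have "\<omega> \<in> borel_measurable (restrict_space borel {0<..})" by simp
  then have "(\<lambda>t. ennreal (\<omega> t)) \<in> borel_measurable (restrict_space borel {0<..})"
    by measurable
  then show ?thesis
    unfolding weight_density_def [abs_def]
    by (subst (asm) borel_measurable_restrict_space_iff_ennreal) auto
qed

lemma set_nn_integral_weight:
  "(\<integral>\<^sup>+t\<in>{0..}. F t * ennreal (\<omega> t) \<partial>lebesgue) = (\<integral>\<^sup>+t. F t * weight_density \<omega> t \<partial>lborel)"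
  unfolding nn_integral_completion
proof (rule nn_integral_cong_AE)
  show "AE t in lborel. F t * ennreal (\<omega> t) * indicator {0..} t = F t * weight_density \<omega> t"
    using AE_lborel_singleton[of 0]
    by eventually_elim (auto simp: weight_density_def indicator_def)
qed

section \<open>Subadditivity of integrals of rearrangements\<close>

lemma nn_integral_rearrangement_excess_le:
  assumes [measurable]: "h \<in> borel_measurable borel" and l: "0 \<le> l" and a: "0 \<le> a"
  shows "(\<integral>\<^sup>+t. rearrangement h t * indicator {0..a} t \<partial>lborel)
    \<le> ennreal (l * a) + (\<integral>\<^sup>+s. indicator {0..} s * ennreal (max 0 (\<bar>h s\<bar> - l)) \<partial>lborel)"
proof -
  have "(\<integral>\<^sup>+t. rearrangement h t * indicator {0..a} t \<partial>lborel)
      \<le> (\<integral>\<^sup>+t. ennreal l * indicator {0..a} t + indicator {0..} t * (rearrangement h t - ennreal l) \<partial>lborel)"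
  proof (rule nn_integral_mono)
    fix t
    have "rearrangement h t \<le> ennreal l + (rearrangement h t - ennreal l)"
      by (metis add_diff_inverse_ennreal le_iff_add linear order_refl order_trans)
    then show "rearrangement h t * indicator {0..a} t
      \<le> ennreal l * indicator {0..a} t + indicator {0..} t * (rearrangement h t - ennreal l)"
      by (auto simp: indicator_def)
  qed
  also have "\<dots> = ennreal (l * a) + (\<integral>\<^sup>+t. indicator {0..} t * (rearrangement h t - ennreal l) \<partial>lborel)"
    using l a by (simp add: nn_integral_add nn_integral_cmult ennreal_mult)
  also have "(\<integral>\<^sup>+t. indicator {0..} t * (rearrangement h t - ennreal l) \<partial>lborel) =
      (\<integral>\<^sup>+s. indicator {0..} s * ennreal (max 0 (\<bar>h s\<bar> - l)) \<partial>lborel)"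
    using nn_integral_rearrangement[of "\<lambda>s. max 0 (\<bar>h s\<bar> - l)"]
    by (simp add: rearrangement_excess l)
  finally show ?thesis .
qed

text \<open>The integral of h* over [0,a] is the minimum over l >= 0 of l a plus the integral of the
  excess of |h| over l. The minimum is attained at l = h*(a), since h* is at least l up to a and at
  most l beyond.\<close>

lemma nn_integral_rearrangement_excess_eq:
  assumes [measurable]: "h \<in> borel_measurable borel" and l: "0 \<le> l" "rearrangement h a = ennreal l" and a: "0 \<le> a"
  shows "(\<integral>\<^sup>+t. rearrangement h t * indicator {0..a} t \<partial>lborel)
    = ennreal (l * a) + (\<integral>\<^sup>+s. indicator {0..} s * ennreal (max 0 (\<bar>h s\<bar> - l)) \<partial>lborel)"
proof (rule antisym[OF nn_integral_rearrangement_excess_le])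
  have "ennreal (l * a) + (\<integral>\<^sup>+s. indicator {0..} s * ennreal (max 0 (\<bar>h s\<bar> - l)) \<partial>lborel) = 
     ennreal (l * a) + (\<integral>\<^sup>+t. indicator {0..} t * (rearrangement h t - ennreal l) \<partial>lborel)"
    using nn_integral_rearrangement[of "\<lambda>s. max 0 (\<bar>h s\<bar> - l)"]
    by (simp add: rearrangement_excess l)
  also have "\<dots> = (\<integral>\<^sup>+t. ennreal l * indicator {0..a} t + indicator {0..} t * (rearrangement h t - ennreal l) \<partial>lborel)"
    using l a by (simp add: nn_integral_add nn_integral_cmult ennreal_mult)
  also have "\<dots> \<le> (\<integral>\<^sup>+t. rearrangement h t * indicator {0..a} t \<partial>lborel)"
  proof (rule nn_integral_mono)
    fix t
    consider "t < 0" | "0 \<le> t" "t \<le> a" | "a < t" by linarith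
    then show "ennreal l * indicator {0..a} t + indicator {0..} t * (rearrangement h t - ennreal l)
      \<le> rearrangement h t * indicator {0..a} t"
    proof cases
      case 2
      then have "ennreal l \<le> rearrangement h t"
        using antimonoD[OF antimono_rearrangement, of t a h] l by simp
      with 2 show ?thesis by (simp add: add_diff_inverse_ennreal)
    next
      case 3
      then have "rearrangement h t \<le> ennreal l"
        using antimonoD[OF antimono_rearrangement, of a t h] l by simp
      then have "rearrangement h t - ennreal l = 0"
        by (simp add: diff_eq_0_iff_ennreal le_less_trans)
      with 3 show ?thesis by simp
    qed simp
  qed
  finally show "ennreal (l * a) + (\<integral>\<^sup>+s. indicator {0..} s * ennreal (max 0 (\<bar>h s\<bar> - l)) \<partial>lborel)
    \<le> (\<integral>\<^sup>+t. rearrangement h t * indicator {0..a} t \<partial>lborel)" .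
qed (use assms in auto)

text \<open>If l and m are the optimal levels for f and g, then l + m is an admissible level for f +
  g, and the excess of |f + g| over l + m is at most the sum of the two excesses.\<close>

lemma nn_integral_rearrangement_add_Icc:
  assumes [measurable]: "f \<in> borel_measurable borel" "g \<in> borel_measurable borel" and a: "0 < a"
  shows "(\<integral>\<^sup>+t. rearrangement (\<lambda>s. f s + g s) t * indicator {0..a} t \<partial>lborel)
    \<le> (\<integral>\<^sup>+t. rearrangement f t * indicator {0..a} t \<partial>lborel) + (\<integral>\<^sup>+t. rearrangement g t * indicator {0..a} t \<partial>lborel)"
proof -
  \<comment> \<open>An infinite value at a spreads over all of [0,a] by monotonicity; the right-hand
    side of the claim is then infinite.\<close>
  have inf: "(\<integral>\<^sup>+t. rearrangement h t * indicator {0..a} t \<partial>lborel) = top" if "rearrangement h a = top" for h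
  proof -
    have "(\<integral>\<^sup>+t. top * indicator {0..a} t \<partial>lborel) \<le> (\<integral>\<^sup>+t. rearrangement h t * indicator {0..a} t \<partial>lborel)"
      using antimonoD[OF antimono_rearrangement, of _ a h] that
      by (intro nn_integral_mono) (auto simp: indicator_def)
    moreover have "(\<integral>\<^sup>+t. top * indicator {0..a} t \<partial>lborel) = top"
      using a by (subst nn_integral_cmult) (auto simp: ennreal_top_mult)
    ultimately show ?thesis by (simp add: top_unique)
  qed
  show ?thesis
  proof (cases "rearrangement f a = top \<or> rearrangement g a = top")
    case True
    then show ?thesis using inf by auto
  next
    case False
    then obtain l m where l: "0 \<le> l" "rearrangement f a = ennreal l" and m: "0 \<le> m" "rearrangement g a = ennreal m"
      by (cases "rearrangement f a"; cases "rearrangement g a") auto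
    have "(\<integral>\<^sup>+t. rearrangement (\<lambda>s. f s + g s) t * indicator {0..a} t \<partial>lborel)
        \<le> ennreal ((l + m) * a) + (\<integral>\<^sup>+s. indicator {0..} s * ennreal (max 0 (\<bar>f s + g s\<bar> - (l + m))) \<partial>lborel)"
      using l m a by (intro nn_integral_rearrangement_excess_le) auto
    also have "\<dots> \<le> ennreal ((l + m) * a) + (\<integral>\<^sup>+s. indicator {0..} s * ennreal (max 0 (\<bar>f s\<bar> - l))
        + indicator {0..} s * ennreal (max 0 (\<bar>g s\<bar> - m)) \<partial>lborel)"
      by (intro add_left_mono nn_integral_mono)
        (auto simp: indicator_def ennreal_plus[symmetric] simp del: ennreal_plus intro!: ennreal_leI)
    also have "\<dots> = (ennreal (l * a) + (\<integral>\<^sup>+s. indicator {0..} s * ennreal (max 0 (\<bar>f s\<bar> - l)) \<partial>lborel))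
        + (ennreal (m * a) + (\<integral>\<^sup>+s. indicator {0..} s * ennreal (max 0 (\<bar>g s\<bar> - m)) \<partial>lborel))"
      using l m a by (simp add: nn_integral_add distrib_right ennreal_plus[symmetric] add.assoc add.left_commute del: ennreal_plus)
    also have "\<dots> = (\<integral>\<^sup>+t. rearrangement f t * indicator {0..a} t \<partial>lborel) + (\<integral>\<^sup>+t. rearrangement g t * indicator {0..a} t \<partial>lborel)"
      using l m a by (simp add: nn_integral_rearrangement_excess_eq)
    finally show ?thesis .
  qed
qed

text \<open>A bounded nonempty A agrees with [0, Sup A] up to its endpoints. An unbounded A is the
  whole open half line, where equimeasurability reduces the claim to the triangle
  inequality.\<close>

lemma nn_integral_rearrangement_add_initial:
  assumes [measurable]: "f \<in> borel_measurable borel" "g \<in> borel_measurable borel"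
    and A: "A \<subseteq> {0<..}" and down: "\<And>s t. s \<in> A \<Longrightarrow> 0 < t \<Longrightarrow> t \<le> s \<Longrightarrow> t \<in> A"
  shows "(\<integral>\<^sup>+t. rearrangement (\<lambda>s. f s + g s) t * indicator A t \<partial>lborel)
    \<le> (\<integral>\<^sup>+t. rearrangement f t * indicator A t \<partial>lborel) + (\<integral>\<^sup>+t. rearrangement g t * indicator A t \<partial>lborel)"
proof (cases "A = {}")
  case False
  show ?thesis
  proof (cases "bdd_above A")
    case True
    define a where "a = Sup A"
    obtain s where s: "s \<in> A" using False by auto
    then have a0: "0 < a"
      using cSup_upper[OF s True] A by (auto simp: a_def)
    have up: "t \<le> a" if "t \<in> A" for t
      using that True by (auto simp: a_def intro: cSup_upper)
    have low: "t \<in> A" if "0 < t" "t < a" for t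
      using less_cSupD[OF False, of t] that down by (auto simp: a_def)
    have "AE t in lborel. indicator A t = (indicator {0..a} t :: ennreal)"
      using AE_lborel_singleton[of 0] AE_lborel_singleton[of a]
    proof eventually_elim
      case (elim t)
      then have "t \<in> A \<longleftrightarrow> t \<in> {0..a}"
        using A up[of t] low[of t] by auto
      then show ?case by (auto simp: indicator_def)
    qed
    then have eq: "(\<integral>\<^sup>+t. rearrangement h t * indicator A t \<partial>lborel) = (\<integral>\<^sup>+t. rearrangement h t * indicator {0..a} t \<partial>lborel)" for h
      by (intro nn_integral_cong_AE) (auto elim!: eventually_mono)
    show ?thesis unfolding eq using assms a0 by (intro nn_integral_rearrangement_add_Icc)
  next
    case unb: False
    have "A = {0<..}"
    proof (intro equalityI subsetI)
      fix t :: real assume "t \<in> {0<..}"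
      moreover obtain s where "s \<in> A" "t < s"
        using unb by (auto simp: bdd_above_def not_le)
      ultimately show "t \<in> A" using down by auto
    qed (use A in auto)
    have eq: "(\<integral>\<^sup>+t. rearrangement h t * indicator A t \<partial>lborel) = (\<integral>\<^sup>+t. indicator {0..} t * ennreal \<bar>h t\<bar> \<partial>lborel)"
      if "h \<in> borel_measurable borel" for h
    proof -
      have "(\<integral>\<^sup>+t. rearrangement h t * indicator A t \<partial>lborel) = (\<integral>\<^sup>+t. indicator {0..} t * rearrangement h t \<partial>lborel)"
        using AE_lborel_singleton[of 0] unfolding \<open>A = {0<..}\<close>
        by (intro nn_integral_cong_AE) (auto elim!: eventually_mono simp: indicator_def)
      then show ?thesis using nn_integral_rearrangement[OF that] by simp
    qed
    have "(\<integral>\<^sup>+t. indicator {0..} t * ennreal \<bar>f t + g t\<bar> \<partial>lborel) \<le>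
      (\<integral>\<^sup>+t. indicator {0..} t * ennreal \<bar>f t\<bar> + indicator {0..} t * ennreal \<bar>g t\<bar> \<partial>lborel)"
      by (intro nn_integral_mono) (auto simp: indicator_def ennreal_plus[symmetric] simp del: ennreal_plus intro!: ennreal_leI)
    then show ?thesis
      by (simp add: eq nn_integral_add)
  qed
qed simp

text \<open>The pointwise bound (f + g)* <= f* + g* fails in general; only integrals over initial
  intervals compare. Since the weight is non-increasing, its superlevel sets are such intervals, and
  the layer cake formula in the weight adds up the comparisons.\<close>

lemma lorentz_add:
  assumes w: "weight_function \<omega>"
    and [measurable]: "f \<in> borel_measurable borel" "g \<in> borel_measurable borel"
  shows "lorentz \<omega> (\<lambda>s. f s + g s) \<le> lorentz \<omega> f + lorentz \<omega> g"
proof -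
  note [measurable] = borel_measurable_weight_density[OF w]
  let ?A = "\<lambda>\<theta>. {t. ennreal \<theta> < weight_density \<omega> t}"
  have L: "lorentz \<omega> h = (\<integral>\<^sup>+\<theta>. (\<integral>\<^sup>+t. rearrangement h t * indicator (?A \<theta>) t \<partial>lborel) * indicator {0..} \<theta> \<partial>lborel)" for h
    unfolding lorentz_def by (rule nn_integral_layer_cake) measurable
  have "lorentz \<omega> (\<lambda>s. f s + g s) \<le> (\<integral>\<^sup>+\<theta>.
    ((\<integral>\<^sup>+t. rearrangement f t * indicator (?A \<theta>) t \<partial>lborel) * indicator {0..} \<theta>
     + (\<integral>\<^sup>+t. rearrangement g t * indicator (?A \<theta>) t \<partial>lborel) * indicator {0..} \<theta>) \<partial>lborel)"
    unfolding L distrib_right[symmetric]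
  proof (intro nn_integral_mono mult_right_mono nn_integral_rearrangement_add_initial)
    fix \<theta> :: real
    show "?A \<theta> \<subseteq> {0<..}" by (auto simp: weight_density_def indicator_def split: if_splits)
    fix s t :: real assume s: "s \<in> ?A \<theta>" and t: "0 < t" "t \<le> s"
    then have "0 < s" by simp
    moreover have "\<omega> s \<le> \<omega> t"
      using w t by (auto simp: weight_function_def monotone_on_def)
    ultimately show "t \<in> ?A \<theta>"
      using s t by (auto simp: weight_density_def intro: less_le_trans ennreal_leI)
  qed auto
  also have "\<dots> = lorentz \<omega> f + lorentz \<omega> g"
    unfolding L by (intro nn_integral_add) measurable
  finally show ?thesis .
qed

lemma lorentz_cmult:
  assumes w: "weight_function \<omega>" and "f \<in> borel_measurable borel" and "0 < c"
  shows "lorentz \<omega> (\<lambda>s. c * f s) = ennreal c * lorentz \<omega> f"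
proof -
  note [measurable] = borel_measurable_weight_density[OF w]
  show ?thesis unfolding lorentz_def
    by (simp add: rearrangement_cmult assms mult.assoc nn_integral_cmult)
qed

lemma lorentz_mono:
  assumes "f \<in> borel_measurable borel" "g \<in> borel_measurable borel"
    and "\<And>s. 0 \<le> s \<Longrightarrow> \<bar>f s\<bar> \<le> \<bar>g s\<bar>"
  shows "lorentz \<omega> f \<le> lorentz \<omega> g"
  unfolding lorentz_def by (intro nn_integral_mono mult_right_mono rearrangement_mono assms) auto

section \<open>Orlicz functions\<close>

locale orlicz =
  fixes \<phi> :: "real \<Rightarrow> real"
  assumes orlicz: "orlicz_function \<phi>"
begin

lemma phi_nonneg [simp]: "0 \<le> \<phi> u"
  and phi_convex: "convex_on UNIV \<phi>"
  and phi_minus [simp]: "\<phi> (- u) = \<phi> u"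
  and phi_0 [simp]: "\<phi> 0 = 0"
  and phi_pos: "0 < u \<Longrightarrow> 0 < \<phi> u"
  and phi_lim_0: "((\<lambda>u. \<phi> u / u) \<longlongrightarrow> 0) (at 0)"
  and phi_lim_top: "filterlim (\<lambda>u. \<phi> u / u) at_top at_top"
  using orlicz by (auto simp: orlicz_function_def)

lemma phi_abs [simp]: "\<phi> \<bar>u\<bar> = \<phi> u"
  by (simp add: abs_real_def)

lemma phi_convex_comb:
  assumes "0 \<le> a" "0 \<le> b" "a + b = 1"
  shows "\<phi> (a * u + b * v) \<le> a * \<phi> u + b * \<phi> v"
  using phi_convex assms by (simp add: convex_on_def)

lemma continuous_phi: "continuous_on A \<phi>"
  using convex_on_continuous[OF open_UNIV phi_convex] continuous_on_subset by blast

lemma borel_measurable_phi [measurable]: "\<phi> \<in> borel_measurable borel"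
  using continuous_phi by (rule borel_measurable_continuous_onI)

text \<open>Otherwise convexity would keep \<phi> above the line through 0 and (u, \<phi>(u)) all
  the way down to 0, against \<phi>(t)/t tending to 0.\<close>

lemma phi_scale_less:
  assumes a: "0 < a" "a < 1" and u: "0 < u"
  shows "\<phi> (a * u) < a * \<phi> u"
proof (rule ccontr)
  assume "\<not> ?thesis"
  then have ge: "a * \<phi> u \<le> \<phi> (a * u)" by simp
  define c where "c = \<phi> u / u"
  have c: "0 < c" "\<phi> u = c * u" using u phi_pos by (auto simp: c_def)
  \<comment> \<open>The line of slope c meets \<phi> at u and is at most \<phi> at
    \<open>a * u\<close>; a point t further left where \<phi> fell below the line would violate
    convexity on [t,u].\<close>
  have low: "c * t \<le> \<phi> t" if t: "0 < t" "t < a * u" for t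
  proof -
    have tu: "t < u" using t a u by (smt (verit) mult_less_cancel_right1)
    define s where "s = (a * u - t) / (u - t)"
    have s: "0 < s" "s < 1" using t a u tu by (auto simp: s_def field_simps)
    have "s * (u - t) = a * u - t" using tu by (simp add: s_def)
    then have eq: "a * u = (1 - s) * t + s * u" by (simp add: algebra_simps)
    have "\<phi> (a * u) \<le> (1 - s) * \<phi> t + s * \<phi> u"
      unfolding eq using s by (intro phi_convex_comb) auto
    with ge have "c * (a * u) \<le> (1 - s) * \<phi> t + s * (c * u)"
      by (simp add: c(2) mult.left_commute)
    then have "(1 - s) * (c * t) \<le> (1 - s) * \<phi> t"
      unfolding eq by (simp add: algebra_simps)
    with s show ?thesis by simp
  qed
  obtain d where d: "0 < d" "\<And>t. t \<noteq> 0 \<Longrightarrow> dist t 0 < d \<Longrightarrow> dist (\<phi> t / t) 0 < c"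
    using tendstoD[OF phi_lim_0 c(1)] unfolding eventually_at by auto
  define t where "t = min d (a * u) / 2"
  have "0 < a * u" using a u by simp
  then have t: "0 < t" "t < d" "t < a * u" using d by (auto simp: t_def)
  then have "\<phi> t / t < c" using d(2)[of t] by (auto simp: dist_real_def)
  with low[of t] t show False by (simp add: field_simps)
qed

lemma phi_strict_mono: 
  assumes "0 \<le> u" "u < v" 
  shows "\<phi> u < \<phi> v"
proof (cases "u = 0")
  case True
  then show ?thesis using assms phi_pos by simp
next
  case False
  have "\<phi> (u / v * v) < u / v * \<phi> v"
    using assms False by (intro phi_scale_less) auto
  also have "\<dots> \<le> 1 * \<phi> v"
    using assms by (intro mult_right_mono) auto
  finally show ?thesis using assms by simp
qed

lemma phi_mono: "0 \<le> u \<Longrightarrow> u \<le> v \<Longrightarrow> \<phi> u \<le> \<phi> v"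
  using phi_strict_mono[of u v] by (cases "u = v") auto

lemma phi_less_iff: "0 \<le> u \<Longrightarrow> 0 \<le> v \<Longrightarrow> \<phi> u < \<phi> v \<longleftrightarrow> u < v"
  using phi_mono[of v u] phi_strict_mono[of u v] by (cases "u < v") auto

lemma phi_le_iff: "0 \<le> u \<Longrightarrow> 0 \<le> v \<Longrightarrow> \<phi> u \<le> \<phi> v \<longleftrightarrow> u \<le> v"
  using phi_less_iff[of v u] by auto

lemma phi_superlinear: "\<exists>U>0. \<forall>u\<ge>U. C * u \<le> \<phi> u"
proof -
  obtain U where U: "\<And>u. U \<le> u \<Longrightarrow> C \<le> \<phi> u / u"
    using phi_lim_top unfolding filterlim_at_top eventually_at_top_linorder by blast
  show ?thesis
  proof (intro exI[of _ "max U 1"] conjI allI impI)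
    fix u assume "max U 1 \<le> u"
    then show "C * u \<le> \<phi> u" using U[of u] by (simp add: field_simps)
  qed simp
qed

lemma phi_surj:
  assumes "0 \<le> r"
  shows "\<exists>u\<ge>0. \<phi> u = r"
proof -
  obtain U where U: "0 < U" "\<And>u. U \<le> u \<Longrightarrow> 1 * u \<le> \<phi> u"
    using phi_superlinear[of 1] by blast
  have "r \<le> \<phi> (max U r)" using U(2)[of "max U r"] by simp
  moreover have "0 \<le> max U r" using U by simp
  ultimately show ?thesis
    using IVT'[of \<phi> 0 r "max U r"] assms continuous_phi[of "{0..max U r}"] by auto
qed

lemma phi_small:
  assumes "0 < e"
  shows "\<exists>d>0. \<phi> d \<le> e"
  using phi_surj[of e] assms by (metis less_eq_real_def order_refl phi_0)

text \<open>On the nonnegative numbers \<phi> is strictly increasing and onto, so every level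
  \<theta> of the composition is the level u of x with \<phi>(u) = \<theta>.\<close>

lemma rearrangement_phi:
  assumes x: "x \<in> borel_measurable borel"
  shows "rearrangement (\<lambda>s. \<phi> (x s)) t = orlicz_ext \<phi> (rearrangement x t)"
proof (rule ennreal_eqI_le)
  fix \<theta> :: real assume \<theta>: "0 \<le> \<theta>"
  then obtain u where u: "0 \<le> u" "\<phi> u = \<theta>" using phi_surj by blast
  have px: "(\<lambda>s. \<phi> (x s)) \<in> borel_measurable borel" using x by measurable
  have eq: "{s. 0 \<le> s \<and> \<theta> < \<bar>\<phi> (x s)\<bar>} = {s. 0 \<le> s \<and> u < \<bar>x s\<bar>}"
    using u phi_less_iff[of u "\<bar>x s\<bar>" for s] by auto
  have "rearrangement (\<lambda>s. \<phi> (x s)) t \<le> ennreal \<theta> \<longleftrightarrow> rearrangement x t \<le> ennreal u"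
    using rearrangement_le_iff[OF px \<theta>, of t] rearrangement_le_iff[OF x, of u t] u
    by (simp only: distribution_fun_borel[OF x] distribution_fun_borel[OF px] eq)
  also have "\<dots> \<longleftrightarrow> orlicz_ext \<phi> (rearrangement x t) \<le> ennreal \<theta>"
    using u by (cases "rearrangement x t") (auto simp: orlicz_ext_def top_unique phi_le_iff)
  finally show "rearrangement (\<lambda>s. \<phi> (x s)) t \<le> ennreal \<theta> \<longleftrightarrow> orlicz_ext \<phi> (rearrangement x t) \<le> ennreal \<theta>" .
qed

lemma modular_eq_lorentz:
  assumes "x \<in> borel_measurable borel"
  shows "modular \<phi> \<omega> x = lorentz \<omega> (\<lambda>s. \<phi> (x s))"
  unfolding modular_def lorentz_def set_nn_integral_weight
  by (simp add: rearrangement_phi[OF assms])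

section \<open>The complementary function and Young's inequality\<close>

abbreviation psi :: "real \<Rightarrow> real" where "psi \<equiv> complementary \<phi>"

text \<open>Guarantees that the real supremum is a genuine one: beyond U superlinear growth makes
  the expression nonpositive, and below U it is at most U |v|.\<close>

lemma psi_bdd: "bdd_above ((\<lambda>u. \<bar>u * v\<bar> - \<phi> u) ` {0<..})"
proof -
  obtain U where U: "0 < U" "\<And>u. U \<le> u \<Longrightarrow> \<bar>v\<bar> * u \<le> \<phi> u"
    using phi_superlinear[of "\<bar>v\<bar>"] by blast
  show ?thesis
  proof (rule bdd_aboveI2)
    fix u :: real assume u: "u \<in> {0<..}"
    show "\<bar>u * v\<bar> - \<phi> u \<le> U * \<bar>v\<bar>"
    proof (cases "U \<le> u")
      case True
      have "0 \<le> U * \<bar>v\<bar>" using U by simp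
      with True U(2)[of u] u show ?thesis by (simp add: abs_mult mult.commute)
    next
      case False
      then have "u * \<bar>v\<bar> \<le> U * \<bar>v\<bar>" by (intro mult_right_mono) auto
      moreover have "\<bar>u * v\<bar> = u * \<bar>v\<bar>" using u by (simp add: abs_mult)
      ultimately show ?thesis using phi_nonneg[of u] by linarith
    qed
  qed
qed

lemma psi_ge: "0 < u \<Longrightarrow> u * \<bar>v\<bar> - \<phi> u \<le> psi v"
  using cSUP_upper[OF _ psi_bdd, of u v] by (simp add: complementary_def abs_mult)

lemma psi_le:
  assumes "\<And>u. 0 < u \<Longrightarrow> u * \<bar>v\<bar> - \<phi> u \<le> b"
  shows "psi v \<le> b"
  unfolding complementary_def using assms
  by (intro cSUP_least) (auto simp: abs_mult)

text \<open>The supremum runs over u > 0, so the value 0 at u = 0 is only approached; this is where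
  small values of \<phi> are used.\<close>

lemma psi_nonneg: "0 \<le> psi v"
proof (rule field_le_epsilon)
  fix e :: real assume "0 < e"
  then obtain d where d: "0 < d" "\<phi> d \<le> e" using phi_small by blast
  have "0 \<le> d * \<bar>v\<bar>" using d by simp
  then have "- e \<le> psi v"
    using psi_ge[OF d(1), of v] d(2) by linarith
  then show "0 \<le> psi v + e" by simp
qed

lemma young: "0 \<le> u \<Longrightarrow> 0 \<le> v \<Longrightarrow> u * v \<le> \<phi> u + psi v"
  using psi_ge[of u v] psi_nonneg[of v] by (cases "u = 0") auto

lemma psi_mono:
  assumes "0 \<le> v" "v \<le> w"
  shows "psi v \<le> psi w"
proof (rule psi_le)
  fix u :: real assume u: "0 < u"
  have "u * \<bar>v\<bar> \<le> u * \<bar>w\<bar>" using assms u by (intro mult_left_mono) auto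
  with psi_ge[OF u, of w] show "u * \<bar>v\<bar> - \<phi> u \<le> psi w" by linarith
qed

lemma psi_0 [simp]: "psi 0 = 0"
  by (rule antisym[OF psi_le psi_nonneg]) auto

lemma psi_convex_comb:
  assumes ab: "0 \<le> a" "0 \<le> b" "a + b = 1" and "0 \<le> v" "0 \<le> w"
  shows "psi (a * v + b * w) \<le> a * psi v + b * psi w"
proof (rule psi_le)
  fix u :: real assume u: "0 < u"
  have "a * (u * v - \<phi> u) + b * (u * w - \<phi> u) \<le> a * psi v + b * psi w"
    using psi_ge[OF u, of v] psi_ge[OF u, of w] assms by (intro add_mono mult_left_mono) auto
  moreover have "a * (u * v - \<phi> u) + b * (u * w - \<phi> u) = u * (a * v + b * w) - (a + b) * \<phi> u"
    by (simp add: algebra_simps)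
  ultimately show "u * \<bar>a * v + b * w\<bar> - \<phi> u \<le> a * psi v + b * psi w"
    using assms by simp
qed

section \<open>Supporting slopes and the equality case of Young's inequality\<close>

definition subgrad :: "real \<Rightarrow> real" where
  "subgrad u = (SOME m. \<forall>w. \<phi> u + m * (w - u) \<le> \<phi> w)"

lemma subgrad: "\<phi> u + subgrad u * (w - u) \<le> \<phi> w"
proof -
  have "\<exists>m. \<forall>w. \<phi> u + m * (w - u) \<le> \<phi> w"
    using convex_le_Inf_differential[OF phi_convex, of u] by auto
  from someI_ex[OF this] show ?thesis unfolding subgrad_def by blast
qed

text \<open>Since \<phi>(t)/t tends to 0, comparing the supporting line at 0 with \<phi> at small
  points on both sides leaves no slope but 0. Monotonicity then makes all slopes at nonnegative
  points nonnegative.\<close>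

lemma subgrad_0 [simp]: "subgrad 0 = 0"
proof -
  have "\<bar>subgrad 0\<bar> \<le> e" if e: "0 < e" for e :: real
  proof -
    obtain d where d: "0 < d" "\<And>t. t \<noteq> 0 \<Longrightarrow> dist t 0 < d \<Longrightarrow> dist (\<phi> t / t) 0 < e"
      using tendstoD[OF phi_lim_0 e] unfolding eventually_at by auto
    have "\<phi> (d / 2) \<le> e * (d / 2)"
      using d(2)[of "d / 2"] d(1) by (auto simp: dist_real_def field_simps)
    then have "subgrad 0 * (d / 2) \<le> e * (d / 2)" "- subgrad 0 * (d / 2) \<le> e * (d / 2)"
      using subgrad[of 0 "d / 2"] subgrad[of 0 "- (d / 2)"] by auto
    then have "subgrad 0 \<le> e" "- subgrad 0 \<le> e"
      using d(1) by (auto simp only: mult_le_cancel_right)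
    then show ?thesis by linarith
  qed
  then show ?thesis by (metis abs_le_zero_iff dense_ge)
qed

text \<open>This holds for every selection of supporting slopes: add the two support inequalities.
  Borel measurability of the chosen selection follows from it.\<close>

lemma subgrad_mono: "u \<le> v \<Longrightarrow> subgrad u \<le> subgrad v"
proof (cases "u = v")
  case False
  assume "u \<le> v"
  have "subgrad u * (v - u) \<le> subgrad v * (v - u)"
    using subgrad[of u v] subgrad[of v u] by (simp add: algebra_simps)
  with False \<open>u \<le> v\<close> show ?thesis by simp
qed simp

lemma subgrad_nonneg: "0 \<le> u \<Longrightarrow> 0 \<le> subgrad u"
  using subgrad_mono[of 0 u] by simp

text \<open>For u >= 0 this is the complementary function at \<open>subgrad u\<close>, by equality
  in Young's inequality; \<open>psi_subgrad_le\<close> records the upper bound.\<close>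

definition young_gap :: "real \<Rightarrow> real" where
  "young_gap u = u * subgrad u - \<phi> u"

lemma young_gap_0 [simp]: "young_gap 0 = 0"
  by (simp add: young_gap_def)

lemma young_gap_nonneg: "0 \<le> young_gap u"
  using subgrad[of u 0] by (simp add: young_gap_def mult.commute)

lemma psi_subgrad_le:
  assumes "0 \<le> u"
  shows "psi (subgrad u) \<le> young_gap u"
proof (rule psi_le)
  fix w :: real
  show "w * \<bar>subgrad u\<bar> - \<phi> w \<le> young_gap u"
    using subgrad[of u w] subgrad_nonneg[OF assms] by (simp add: young_gap_def algebra_simps)
qed

lemma young_gap_le: "young_gap u \<le> \<phi> (2 * u)"
proof -
  have "\<phi> u + subgrad u * u \<le> \<phi> (2 * u)"
    using subgrad[of u "2 * u"] by simp
  moreover have "0 \<le> \<phi> u" by simp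
  ultimately show ?thesis unfolding young_gap_def mult.commute[of u] by linarith
qed

text \<open>Forces the gap to grow without bound: the supporting line at u, evaluated at 0, gives C
  <= \<open>subgrad u\<close>, and evaluated at 1 it gives \<open>subgrad u\<close> - \<phi>(1) as a
  lower bound for the gap.\<close>

lemma young_gap_ge:
  assumes "C * u \<le> \<phi> u" "0 < u"
  shows "C - \<phi> 1 \<le> young_gap u"
proof -
  have "C * u \<le> subgrad u * u"
    using assms(1) subgrad[of u 0] by (simp add: algebra_simps)
  then have "C \<le> subgrad u" using assms(2) by simp
  then show ?thesis using subgrad[of u 1] by (simp add: young_gap_def algebra_simps)
qed

lemma borel_measurable_subgrad [measurable]: "subgrad \<in> borel_measurable borel"
  by (rule borel_measurable_mono) (simp add: monoI subgrad_mono)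

lemma borel_measurable_young_gap [measurable]: "young_gap \<in> borel_measurable borel"
  unfolding young_gap_def[abs_def] by measurable

lemma young_ext: "a * b \<le> orlicz_ext \<phi> a + orlicz_ext psi b"
proof (cases a)
  case (real u)
  show ?thesis
  proof (cases b)
    case (real v)
    with \<open>0 \<le> u\<close> \<open>a = ennreal u\<close> young[of u v] show ?thesis
      by (simp add: orlicz_ext_def psi_nonneg ennreal_leI flip: ennreal_mult ennreal_plus)
  qed (simp add: orlicz_ext_def)
qed (simp add: orlicz_ext_def)

end

section \<open>Upper bound for the Orlicz norm\<close>

lemma orlicz_ext_mono:
  assumes "\<And>u v. 0 \<le> u \<Longrightarrow> u \<le> v \<Longrightarrow> f u \<le> f v" and "a \<le> b"
  shows "orlicz_ext f a \<le> orlicz_ext f b"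
  using assms(2)
  by (cases a; cases b) (auto simp: orlicz_ext_def top_unique intro!: ennreal_leI assms(1))

lemma borel_measurable_orlicz_ext:
  assumes "\<And>u v. 0 \<le> u \<Longrightarrow> u \<le> v \<Longrightarrow> f u \<le> f v"
  shows "(\<lambda>t. orlicz_ext f (rearrangement x t)) \<in> borel_measurable borel"
  by (intro borel_measurable_antimono_ennreal antimonoI orlicz_ext_mono assms
      antimonoD[OF antimono_rearrangement])

lemma orlicz_norm_eq:
  "orlicz_norm \<phi> \<omega> x =
     (SUP y\<in>{y \<in> borel_measurable (lebesgue_on {0..}). modular (complementary \<phi>) \<omega> y \<le> 1}.
        \<integral>\<^sup>+t. rearrangement x t * rearrangement y t * weight_density \<omega> t \<partial>lborel)"
  unfolding orlicz_norm_def set_nn_integral_weight ..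

context orlicz
begin

text \<open>The easy half of the Amemiya formula: Young's inequality is applied pointwise to the
  rearrangements of k z and y and integrated against the weight.\<close>

lemma orlicz_norm_le:
  assumes w: "weight_function \<omega>" and z: "z \<in> borel_measurable borel" and k: "0 < k"
  shows "orlicz_norm \<phi> \<omega> z \<le> ennreal (1 / k) * (1 + lorentz \<omega> (\<lambda>s. \<phi> (k * z s)))"
  unfolding orlicz_norm_eq
proof (rule SUP_least)
  note [measurable] = borel_measurable_weight_density[OF w] z
    borel_measurable_orlicz_ext[OF phi_mono] borel_measurable_orlicz_ext[OF psi_mono]
  fix y assume y: "y \<in> {y \<in> borel_measurable (lebesgue_on {0..}). modular psi \<omega> y \<le> 1}"
  have kk: "ennreal (1 / k) * ennreal k = 1"
    using k by (simp flip: ennreal_mult)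
  have "(\<integral>\<^sup>+t. rearrangement z t * rearrangement y t * weight_density \<omega> t \<partial>lborel)
     = (\<integral>\<^sup>+t. ennreal (1 / k) * (rearrangement (\<lambda>s. k * z s) t * rearrangement y t * weight_density \<omega> t) \<partial>lborel)"
    using k by (simp add: rearrangement_cmult mult.assoc[symmetric] kk)
  also have "\<dots> = ennreal (1 / k) * (\<integral>\<^sup>+t. rearrangement (\<lambda>s. k * z s) t * rearrangement y t * weight_density \<omega> t \<partial>lborel)"
    by (rule nn_integral_cmult) measurable
  also have "\<dots> \<le> ennreal (1 / k) * (\<integral>\<^sup>+t. orlicz_ext psi (rearrangement y t) * weight_density \<omega> t
      + orlicz_ext \<phi> (rearrangement (\<lambda>s. k * z s) t) * weight_density \<omega> t \<partial>lborel)"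
    unfolding distrib_right[symmetric] add.commute[of "orlicz_ext psi _"]
    by (intro mult_left_mono nn_integral_mono mult_right_mono young_ext) auto
  also have "\<dots> = ennreal (1 / k) * (modular psi \<omega> y + modular \<phi> \<omega> (\<lambda>s. k * z s))"
    unfolding modular_def set_nn_integral_weight by (subst nn_integral_add) measurable
  also have "\<dots> \<le> ennreal (1 / k) * (1 + lorentz \<omega> (\<lambda>s. \<phi> (k * z s)))"
    using y by (intro mult_left_mono add_mono) (auto simp: modular_eq_lorentz)
  finally show "(\<integral>\<^sup>+t. rearrangement z t * rearrangement y t * weight_density \<omega> t \<partial>lborel)
    \<le> ennreal (1 / k) * (1 + lorentz \<omega> (\<lambda>s. \<phi> (k * z s)))" .
qed

end

section \<open>Weights and strict monotonicity\<close>

lemma rearrangement_antimono_upper: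
  assumes y: "antimono y" "\<And>t. 0 \<le> y t" and ym: "y \<in> borel_measurable borel" and t: "0 \<le> t"
  shows "rearrangement y t \<le> ennreal (y t)"
proof -
  have "emeasure lborel {s. 0 \<le> s \<and> y t < \<bar>y s\<bar>} \<le> emeasure lborel {0..t}"
    using antimonoD[OF y(1), of t] y(2) by (intro emeasure_mono) (auto simp: not_less[symmetric])
  then show ?thesis
    using rearrangement_le_iff[OF ym y(2)] t by (simp add: distribution_fun_borel[OF ym])
qed

lemma rearrangement_antimono_lower:
  assumes y: "antimono y" "\<And>t. 0 \<le> y t" and ym: "y \<in> borel_measurable borel" and t: "0 \<le> t" "t < u"
  shows "ennreal (y u) \<le> rearrangement y t"
proof (rule ccontr)
  assume "\<not> ?thesis"
  then obtain r where r: "0 \<le> r" "rearrangement y t = ennreal r" "r < y u"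
    by (cases "rearrangement y t") (auto simp: ennreal_less_iff)
  have "emeasure lborel {0..u} \<le> emeasure lborel {s. 0 \<le> s \<and> r < \<bar>y s\<bar>}"
    using antimonoD[OF y(1), of _ u] r ym by (intro emeasure_mono) (force, simp)
  also have "\<dots> \<le> ennreal t"
    using rearrangement_le_iff[OF ym r(1), of t] r by (simp add: distribution_fun_borel[OF ym])
  finally show False using t by simp
qed

text \<open>The two preceding bounds squeeze the rearrangement between the right limit of y and its
  value. These agree at continuity points, and a monotone function has only countably many
  others.\<close>

lemma AE_rearrangement_antimono:
  assumes y: "antimono y" "\<And>t. 0 \<le> y t"
  shows "AE t in lborel. 0 < t \<longrightarrow> rearrangement y t = ennreal (y t)"
proof -
  have m: "mono (\<lambda>t. - y t)" using y(1) by (auto simp: monotone_def)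
  have ym: "y \<in> borel_measurable borel"
    using borel_measurable_uminus[OF borel_measurable_mono[OF m]] by simp
  have "{a. \<not> isCont y a} = {a. \<not> isCont (\<lambda>t. - y t) a}"
    using continuous_minus[of "at a" y for a] continuous_minus[of "at a" "\<lambda>t. - y t" for a] by auto
  then have "countable {a. \<not> isCont y a}"
    using mono_ctble_discont[OF m] by simp
  then have "{a. \<not> isCont y a} \<in> null_sets lborel"
    by (rule countable_imp_null_set_lborel)
  from AE_not_in[OF this] show ?thesis
  proof eventually_elim
    case (elim t)
    show ?case
    proof
      assume t: "0 < t"
      show "rearrangement y t = ennreal (y t)"
      proof (rule antisym)
        have "((\<lambda>s. ennreal (y s)) \<longlongrightarrow> ennreal (y t)) (at_right t)"
          using elim by (intro tendsto_ennrealI) (auto simp: isCont_def intro: filterlim_mono at_le)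
        moreover have "eventually (\<lambda>s. ennreal (y s) \<le> rearrangement y t) (at_right t)"
          using rearrangement_antimono_lower[OF y ym, of t] t
          by (intro eventually_at_right_less[THEN eventually_mono]) auto
        ultimately show "ennreal (y t) \<le> rearrangement y t"
          by (rule tendsto_upperbound) simp
      qed (use rearrangement_antimono_upper[OF y ym] t in auto)
    qed
  qed
qed

section \<open>Integrals and positivity of the weight\<close>

lemma weight_locally_finite:
  assumes w: "weight_function \<omega>"
  shows "(\<integral>\<^sup>+t. weight_density \<omega> t * indicator {..a} t \<partial>lborel) < \<infinity>"
proof -
  define b where "b = max a 1"
  have "set_integrable lebesgue {0..b} \<omega>"
    using w by (auto simp: weight_function_def b_def)
  then have "(\<integral>\<^sup>+t. ennreal (norm (indicat_real {0..b} t *\<^sub>R \<omega> t)) \<partial>lebesgue) < \<infinity>"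
    unfolding set_integrable_def integrable_iff_bounded by blast
  moreover have "(\<integral>\<^sup>+t. weight_density \<omega> t * indicator {..a} t \<partial>lborel)
      \<le> (\<integral>\<^sup>+t. ennreal (norm (indicat_real {0..b} t *\<^sub>R \<omega> t)) \<partial>lborel)"
    by (intro nn_integral_mono)
      (auto simp: weight_density_def indicator_def b_def intro!: ennreal_leI split: if_splits)
  ultimately show ?thesis unfolding nn_integral_completion by (rule le_less_trans[rotated])
qed

lemma weight_initial_pos:
  assumes w: "weight_function \<omega>" and a: "0 < a" "\<omega> a \<noteq> 0"
  shows "0 < (\<integral>\<^sup>+t. weight_density \<omega> t * indicator {..a} t \<partial>lborel)"
proof -
  have pos: "0 < \<omega> a" using w a by (auto simp: weight_function_def less_le)
  have "0 < ennreal (\<omega> a) * ennreal a"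
    using pos a by (simp add: ennreal_zero_less_mult_iff)
  also have "\<dots> = (\<integral>\<^sup>+t. ennreal (\<omega> a) * indicator {0<..a} t \<partial>lborel)"
    using a by (subst nn_integral_cmult) auto
  also have "\<dots> \<le> (\<integral>\<^sup>+t. weight_density \<omega> t * indicator {..a} t \<partial>lborel)"
    using w a by (intro nn_integral_mono)
      (auto simp: weight_density_def indicator_def weight_function_def monotone_on_def intro!: ennreal_leI)
  finally show ?thesis .
qed

text \<open>A zero at t would persist to the right of t, and the total weight would reduce to a
  finite integral over a bounded interval.\<close>

lemma weight_positive:
  assumes w: "weight_function \<omega>" and inf: "(\<integral>\<^sup>+t. weight_density \<omega> t \<partial>lborel) = \<infinity>" and t: "0 < t"
  shows "0 < \<omega> t"
proof (rule ccontr)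
  assume "\<not> ?thesis"
  then have "\<omega> t = 0" using w t by (auto simp: weight_function_def less_le)
  then have "\<omega> s = 0" if "t \<le> s" for s
    using w t that by (auto simp: weight_function_def monotone_on_def intro!: antisym) 
      (metis greaterThan_iff less_le_trans)
  then have "(\<integral>\<^sup>+s. weight_density \<omega> s \<partial>lborel) = (\<integral>\<^sup>+s. weight_density \<omega> s * indicator {..t} s \<partial>lborel)"
    by (intro nn_integral_cong) (auto simp: weight_density_def indicator_def)
  with weight_locally_finite[OF w, of t] inf show False by simp
qed

text \<open>Strict monotonicity. Equal integrals and a positive weight force h* <= f* almost
  everywhere, hence equal distribution functions. The level sets of f and h are nested, and having
  equal finite measure they differ by null sets.\<close>

lemma lorentz_eq_imp_AE_eq:
  assumes w: "weight_function \<omega>" and inf: "(\<integral>\<^sup>+t. weight_density \<omega> t \<partial>lborel) = \<infinity>"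
    and fm: "f \<in> borel_measurable borel" and hm: "h \<in> borel_measurable borel"
    and le: "\<And>s. 0 \<le> s \<Longrightarrow> \<bar>f s\<bar> \<le> \<bar>h s\<bar>"
    and fin: "lorentz \<omega> h < \<infinity>" and ge: "lorentz \<omega> h \<le> lorentz \<omega> f"
  shows "AE s in lborel. 0 \<le> s \<longrightarrow> \<bar>f s\<bar> = \<bar>h s\<bar>"
proof -
  note [measurable] = borel_measurable_weight_density[OF w] fm hm
  let ?w = "weight_density \<omega>"
  have fin': "lorentz \<omega> f < \<infinity>"
    using lorentz_mono[OF fm hm le] fin le_less_trans by blast
  have "(\<integral>\<^sup>+t. rearrangement h t * ?w t - rearrangement f t * ?w t \<partial>lborel) = lorentz \<omega> h - lorentz \<omega> f"
    unfolding lorentz_def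
  proof (rule nn_integral_diff)
    show "(\<integral>\<^sup>+t. rearrangement f t * ?w t \<partial>lborel) \<noteq> \<infinity>"
      using fin' by (simp add: lorentz_def)
    show "AE t in lborel. rearrangement f t * ?w t \<le> rearrangement h t * ?w t"
      using rearrangement_mono[OF fm hm le] by (auto intro!: mult_right_mono)
  qed measurable
  also have "\<dots> = 0"
    using ge fin by (simp add: diff_eq_0_iff_ennreal)
  finally have "AE t in lborel. rearrangement h t * ?w t - rearrangement f t * ?w t = 0"
    by (subst (asm) nn_integral_0_iff_AE) auto
  moreover have "AE t in lborel. rearrangement h t * ?w t \<noteq> \<infinity>"
    using fin by (intro nn_integral_PInf_AE) (auto simp: lorentz_def)
  ultimately have AEle: "AE t in lborel. 0 < t \<longrightarrow> rearrangement h t \<le> rearrangement f t"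
  proof eventually_elim
    case (elim t)
    then have "rearrangement h t * ?w t \<le> rearrangement f t * ?w t"
      by (simp add: diff_eq_0_iff_ennreal)
    then show ?case
      using weight_positive[OF w inf, of t]
      by (auto simp: weight_density_def mult_right_mono ennreal_mult_le_mult_iff mult.commute[of _ "ennreal _"])
  qed
  \<comment> \<open>If the level set at \<theta> > 0 had infinite measure, h* would be at least
    \<theta> everywhere and the infinite total weight would make the functional infinite.\<close>
  have dfin: "distribution_fun h \<theta> < top" if "0 < \<theta>" for \<theta> :: real
  proof (rule ccontr)
    assume "\<not> ?thesis"
    then have "distribution_fun h \<theta> = top" by (metis top.not_eq_extremum)
    then have big: "ennreal \<theta> \<le> rearrangement h t" for t
      using rearrangement_le_iff[OF hm, of \<theta> t] that by (cases "rearrangement h t \<le> ennreal \<theta>") (auto simp: top_unique)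
    have "ennreal \<theta> * (\<integral>\<^sup>+t. ?w t \<partial>lborel) = (\<integral>\<^sup>+t. ennreal \<theta> * ?w t \<partial>lborel)"
      by (simp add: nn_integral_cmult)
    also have "\<dots> \<le> lorentz \<omega> h"
      unfolding lorentz_def by (intro nn_integral_mono mult_right_mono big) auto
    finally show False using fin inf that by (simp add: ennreal_mult_top top_unique)
  qed
  have dle: "distribution_fun h \<theta> \<le> distribution_fun f \<theta>" if \<theta>: "0 < \<theta>" for \<theta>
  proof (rule ccontr)
    assume "\<not> ?thesis"
    then have less: "distribution_fun f \<theta> < distribution_fun h \<theta>" by simp
    obtain a where a: "0 \<le> a" "distribution_fun f \<theta> = ennreal a"
      using less by (cases "distribution_fun f \<theta>") auto
    obtain b where b: "0 \<le> b" "distribution_fun h \<theta> = ennreal b"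
      using dfin[OF \<theta>] by (cases "distribution_fun h \<theta>") auto
    have ab: "a < b" using less a b by (simp add: ennreal_less_iff)
    \<comment> \<open>On the interval between the two values of the distribution functions f* <=
      \<theta> < h*, so by \<open>AEle\<close> this interval is null.\<close>
    have "AE t in lborel. t \<notin> {a<..<b}"
      using AEle
    proof eventually_elim
      case (elim t)
      show ?case
      proof
        assume t: "t \<in> {a<..<b}"
        then have "rearrangement f t \<le> ennreal \<theta>"
          using rearrangement_le_iff[OF fm, of \<theta> t] \<theta> a by (simp add: ennreal_leI)
        moreover have "\<not> rearrangement h t \<le> ennreal \<theta>"
          using rearrangement_le_iff[OF hm, of \<theta> t] \<theta> b t a by (simp add: not_le ennreal_less_iff)
        ultimately show False using elim t a by auto
      qed
    qed
    then have "emeasure lborel {a<..<b} = 0"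
      by (subst (asm) AE_iff_measurable[of "{a<..<b}"]) auto
    with ab show False by simp
  qed
  have level: "AE s in lborel. 0 \<le> s \<longrightarrow> \<theta> < \<bar>h s\<bar> \<longrightarrow> \<theta> < \<bar>f s\<bar>" if "0 < \<theta>" for \<theta>
  proof -
    let ?H = "{s. 0 \<le> s \<and> \<theta> < \<bar>h s\<bar>}" and ?F = "{s. 0 \<le> s \<and> \<theta> < \<bar>f s\<bar>}"
    have "emeasure lborel (?H - ?F) = emeasure lborel ?H - emeasure lborel ?F"
    proof (rule emeasure_Diff)
      show "?F \<subseteq> ?H" using le by fastforce
      show "emeasure lborel ?F \<noteq> \<infinity>"
        using distribution_fun_borel[OF fm, of \<theta>] distribution_fun_borel[OF hm, of \<theta>] dfin[OF that]
          emeasure_mono[OF \<open>?F \<subseteq> ?H\<close>, of lborel] by (auto simp: top_unique)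
    qed auto
    also have "\<dots> = 0"
      using dle[OF that] dfin[OF that]
      by (simp add: distribution_fun_borel[OF fm] distribution_fun_borel[OF hm] diff_eq_0_iff_ennreal)
    finally have "?H - ?F \<in> null_sets lborel" by (auto simp: null_sets_def)
    from AE_not_in[OF this] show ?thesis by eventually_elim auto
  qed
  \<comment> \<open>Rational levels suffice to separate |f| from |h|, and they keep the union of
    exceptional sets null.\<close>
  have "AE s in lborel. \<forall>q\<in>\<rat> \<inter> {0<..}. 0 \<le> s \<longrightarrow> q < \<bar>h s\<bar> \<longrightarrow> q < \<bar>f s\<bar>"
    using countable_rat level by (subst AE_ball_countable) (auto intro: countable_Int1)
  then show ?thesis
  proof eventually_elim
    case (elim s)
    show ?case
    proof (intro impI antisym)
      assume s: "0 \<le> s"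
      show "\<bar>f s\<bar> \<le> \<bar>h s\<bar>" using le[OF s] .
      show "\<bar>h s\<bar> \<le> \<bar>f s\<bar>"
      proof (rule ccontr)
        assume "\<not> ?thesis"
        then obtain q where "q \<in> \<rat>" "\<bar>f s\<bar> < q" "q < \<bar>h s\<bar>"
          using Rats_dense_in_real[of "\<bar>f s\<bar>" "\<bar>h s\<bar>"] by auto
        with elim s show False by fastforce
      qed
    qed
  qed
qed

section \<open>The Orlicz norm as an attained Amemiya infimum\<close>

context orlicz
begin

text \<open>Non-increasing test functions equal their own rearrangement almost everywhere, so they
  may be inserted in the supremum directly; g stands for a truncation of the rearrangement of
  x.\<close>

lemma orlicz_norm_ge:
  assumes w: "weight_function \<omega>"
    and y: "antimono y" "\<And>t. 0 \<le> y t"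
    and psi: "(\<integral>\<^sup>+t. ennreal (psi (y t)) * weight_density \<omega> t \<partial>lborel) \<le> 1"
    and g: "\<And>t. 0 < t \<Longrightarrow> ennreal (g t) \<le> rearrangement x t" "\<And>t. 0 \<le> g t"
  shows "(\<integral>\<^sup>+t. ennreal (g t * y t) * weight_density \<omega> t \<partial>lborel) \<le> orlicz_norm \<phi> \<omega> x"
proof -
  have ym: "y \<in> borel_measurable borel"
  proof -
    have "mono (\<lambda>t. - y t)" using y(1) by (auto simp: monotone_def)
    from borel_measurable_uminus[OF borel_measurable_mono[OF this]] show ?thesis by simp
  qed
  have "y \<in> borel_measurable (lebesgue_on {0..})"
    using ym by (intro measurable_restrict_space1 measurable_completion) simp
  moreover have "modular psi \<omega> y = (\<integral>\<^sup>+t. ennreal (psi (y t)) * weight_density \<omega> t \<partial>lborel)"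
    unfolding modular_def set_nn_integral_weight
    using AE_rearrangement_antimono[OF y]
    by (intro nn_integral_cong_AE, eventually_elim)
      (auto simp: orlicz_ext_def y weight_density_def indicator_def)
  ultimately have "(\<integral>\<^sup>+t. rearrangement x t * rearrangement y t * weight_density \<omega> t \<partial>lborel) \<le> orlicz_norm \<phi> \<omega> x"
    unfolding orlicz_norm_eq using psi by (intro SUP_upper) auto
  moreover have "(\<integral>\<^sup>+t. ennreal (g t * y t) * weight_density \<omega> t \<partial>lborel)
      \<le> (\<integral>\<^sup>+t. rearrangement x t * rearrangement y t * weight_density \<omega> t \<partial>lborel)"
    using AE_rearrangement_antimono[OF y]
  proof (intro nn_integral_mono_AE, eventually_elim)
    case (elim t)
    show ?case
    proof (cases "0 < t")
      case True
      with elim g[of t] y show ?thesis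
        by (simp add: ennreal_mult mult_right_mono)
    qed (simp add: weight_density_def)
  qed
  ultimately show ?thesis by (rule order_trans[rotated])
qed

text \<open>The multiplier \<open>k\<close> is taken just below the threshold at which
  \<open>\<integral>\<psi>(subgrad(k g))\<omega>\<close> exceeds 1, and the test function is a convex combination of
  the subgradients on both sides of the threshold. This replaces the usual differentiation of
  \<open>k \<mapsto> \<rho>(k g)\<close>, at the price of the factor \<open>r\<close>.\<close>

lemma amemiya_bounded:
  assumes w: "weight_function \<omega>"
    and g: "antimono g" "\<And>t. 0 \<le> g t" "\<And>t. g t \<le> M" "\<And>t. b \<le> t \<Longrightarrow> g t = 0"
    and a: "0 < a" "\<omega> a \<noteq> 0" "0 < \<delta>" "\<And>t. t \<le> a \<Longrightarrow> \<delta> \<le> g t"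
    and r: "1 < r"
    and x: "\<And>t. 0 < t \<Longrightarrow> ennreal (g t) \<le> rearrangement x t"
  shows "\<exists>k>0. 1 + (\<integral>\<^sup>+t. ennreal (\<phi> (k * g t)) * weight_density \<omega> t \<partial>lborel)
    \<le> ennreal (r * k) * orlicz_norm \<phi> \<omega> x"
proof -
  let ?w = "weight_density \<omega>"
  have gm: "g \<in> borel_measurable borel"
  proof -
    have "mono (\<lambda>t. - g t)" using g(1) by (auto simp: monotone_def)
    from borel_measurable_uminus[OF borel_measurable_mono[OF this]] show ?thesis by simp
  qed
  note [measurable] = borel_measurable_weight_density[OF w] gm
  \<comment> \<open>\<open>G k\<close> dominates the integral of \<psi>(subgrad(k g)) against the
    weight, and unlike that integral it enters Young's inequality with exact equality.\<close>
  define G where "G k = (\<integral>\<^sup>+t. ennreal (young_gap (k * g t)) * ?w t \<partial>lborel)" for k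
  obtain B where B: "0 \<le> B" "(\<integral>\<^sup>+t. ?w t * indicator {..b} t \<partial>lborel) = ennreal B"
    using weight_locally_finite[OF w, of b] by (cases "\<integral>\<^sup>+t. ?w t * indicator {..b} t \<partial>lborel") auto
  obtain A where A: "0 < A" "(\<integral>\<^sup>+t. ?w t * indicator {..a} t \<partial>lborel) = ennreal A"
    using weight_locally_finite[OF w, of a] weight_initial_pos[OF w a(1,2)]
    by (cases "\<integral>\<^sup>+t. ?w t * indicator {..a} t \<partial>lborel") auto
  have M: "0 < M" using a(3) a(4)[of a] g(3)[of a] by linarith
  have G_le: "G k \<le> ennreal (\<phi> (2 * (k * M)) * B)" if k: "0 \<le> k" for k
  proof -
    have "G k \<le> (\<integral>\<^sup>+t. ennreal (\<phi> (2 * (k * M))) * (?w t * indicator {..b} t) \<partial>lborel)"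
      unfolding G_def
    proof (rule nn_integral_mono)
      fix t
      have "young_gap (k * g t) \<le> \<phi> (2 * (k * g t))" by (rule young_gap_le)
      also have "\<dots> \<le> \<phi> (2 * (k * M))"
        using g k by (intro phi_mono) (auto intro!: mult_left_mono)
      finally show "ennreal (young_gap (k * g t)) * ?w t \<le> ennreal (\<phi> (2 * (k * M))) * (?w t * indicator {..b} t)"
        using g(4)[of t] by (cases "t \<le> b") (auto intro!: mult_right_mono ennreal_leI)
    qed
    then show ?thesis using B by (simp add: nn_integral_cmult ennreal_mult)
  qed
  define S where "S = {k. 0 < k \<and> G k \<le> 1}"
  \<comment> \<open>With k = d / (2 M) the bound \<open>G_le\<close> becomes \<phi>(d) B <= B / (B +
    1) <= 1, so S is nonempty.\<close>
  obtain d where d: "0 < d" "\<phi> d \<le> 1 / (B + 1)" using phi_small[of "1 / (B + 1)"] B by auto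
  have "d / (2 * M) \<in> S"
  proof -
    have "\<phi> (2 * (d / (2 * M) * M)) * B \<le> 1 / (B + 1) * B"
      using d M B by (intro mult_right_mono) auto
    also have "\<dots> \<le> 1" using B by simp
    finally have "G (d / (2 * M)) \<le> ennreal 1"
      using G_le[of "d / (2 * M)"] d M by (meson ennreal_leI order_trans less_imp_le divide_pos_pos mult_pos_pos zero_less_numeral)
    then show ?thesis using d M by (simp add: S_def)
  qed
  then have S0: "S \<noteq> {}" by auto
  \<comment> \<open>The slope is chosen so that \<open>young_gap_ge\<close> yields a gap of at least
    2 / A. As the weight of the initial interval up to a is A, \<open>G k\<close> >= 2 once k
    \<delta> >= U, which bounds S.\<close>
  obtain U where U: "0 < U" "\<And>u. U \<le> u \<Longrightarrow> (\<phi> 1 + 2 / A) * u \<le> \<phi> u"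
    using phi_superlinear by blast
  have bdd: "k \<le> U / \<delta>" if "k \<in> S" for k
  proof (rule ccontr)
    assume "\<not> k \<le> U / \<delta>"
    then have k: "U < k * \<delta>" "0 < k" using a that by (auto simp: S_def field_simps)
    have "ennreal 2 = ennreal (2 / A) * ennreal A" using A by (simp flip: ennreal_mult)
    also have "\<dots> = (\<integral>\<^sup>+t. ennreal (2 / A) * (?w t * indicator {..a} t) \<partial>lborel)"
      using A by (simp add: nn_integral_cmult)
    also have "\<dots> \<le> G k"
      unfolding G_def
    proof (rule nn_integral_mono)
      fix t
      show "ennreal (2 / A) * (?w t * indicator {..a} t) \<le> ennreal (young_gap (k * g t)) * ?w t"
      proof (cases "t \<le> a")
        case True
        then have "k * \<delta> \<le> k * g t" using a(4)[of t] k by (intro mult_left_mono) auto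
        then have "U \<le> k * g t" using k(1) by linarith
        then have "2 / A \<le> young_gap (k * g t)"
          using young_gap_ge[OF U(2), of "k * g t"] U(1) by simp
        then show ?thesis using True by (auto intro!: mult_right_mono ennreal_leI)
      qed simp
    qed
    finally show False using that by (auto simp: S_def dest: order_trans)
  qed
  then have bS: "bdd_above S" by (auto simp: bdd_above_def)
  define k0 where "k0 = Sup S"
  have "0 < k0" using cSup_upper[OF \<open>d / (2 * M) \<in> S\<close> bS] d M
    by (simp add: k0_def) (meson divide_pos_pos less_le_trans mult_pos_pos zero_less_numeral)
  \<comment> \<open>Choosing k in S within the factor r of the supremum puts \<open>r * k\<close>
    beyond it, so that G is at most 1 at k and exceeds 1 at \<open>r * k\<close>.\<close>
  then have "k0 / r < k0" using r by (simp add: field_simps)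
  then obtain k where k: "k \<in> S" "k0 / r < k"
    using less_cSupD[OF S0] by (auto simp: k0_def)
  have k_pos: "0 < k" using k by (simp add: S_def)
  have "k0 < r * k" using k(2) r by (simp add: field_simps)
  then have "r * k \<notin> S" using cSup_upper[OF _ bS, of "r * k"] by (auto simp: k0_def)
  then have G2: "1 < G (r * k)" using k_pos r by (auto simp: S_def not_le)
  obtain P where P: "0 \<le> P" "G k = ennreal P" "P \<le> 1"
    using k by (cases "G k") (auto simp: S_def top_unique)
  obtain Q where Q: "G (r * k) = ennreal Q" "1 < Q"
    using G2 G_le[of "r * k"] k_pos r by (cases "G (r * k)") (auto simp: top_unique)
  \<comment> \<open>The weight of the convex combination that turns the two values P <= 1 < Q into
    exactly 1.\<close>
  define m where "m = (1 - P) / (Q - P)"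
  have m: "0 \<le> m" "m \<le> 1" using P Q by (auto simp: m_def)
  have "m * (Q - P) = 1 - P" using P Q by (simp add: m_def)
  then have comb: "(1 - m) * P + m * Q = 1" by (simp add: algebra_simps)
  define y where "y t = (1 - m) * subgrad (k * g t) + m * subgrad (r * k * g t)" for t
  define q where "q t = (1 - m) * young_gap (k * g t) + m * young_gap (r * k * g t)" for t
  have pos: "0 \<le> k * g t" "0 \<le> r * k * g t" "k * g t \<le> r * k * g t" for t
    using k_pos r g(2)[of t] mult_right_mono[of 1 r "k * g t"] by (auto simp: mult.assoc)
  have q_int: "(\<integral>\<^sup>+t. ennreal (q t) * ?w t \<partial>lborel) = 1"
  proof -
    have "(\<integral>\<^sup>+t. ennreal (q t) * ?w t \<partial>lborel) = (\<integral>\<^sup>+t. ennreal (1 - m) * (ennreal (young_gap (k * g t)) * ?w t)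
        + ennreal m * (ennreal (young_gap (r * k * g t)) * ?w t) \<partial>lborel)"
      using m young_gap_nonneg
      by (intro nn_integral_cong) (simp add: q_def ennreal_plus ennreal_mult distrib_right mult.assoc)
    also have "\<dots> = ennreal (1 - m) * G k + ennreal m * G (r * k)"
      unfolding G_def by (simp add: nn_integral_add nn_integral_cmult)
    also have "\<dots> = 1"
      using m P Q comb by (simp flip: ennreal_mult ennreal_plus)
    finally show ?thesis .
  qed
  have y_anti: "antimono y"
  proof (rule antimonoI)
    fix s t :: real assume "s \<le> t"
    then have "g t \<le> g s" by (rule antimonoD[OF g(1)])
    then show "y t \<le> y s"
      unfolding y_def using m k_pos r by (intro add_mono mult_left_mono subgrad_mono) auto
  qed
  have y_pos: "0 \<le> y t" for t
    unfolding y_def using m subgrad_nonneg[OF pos(1)[of t]] subgrad_nonneg[OF pos(2)[of t]] by simp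
  have "psi (y t) \<le> q t" for t
  proof -
    have "psi (y t) \<le> (1 - m) * psi (subgrad (k * g t)) + m * psi (subgrad (r * k * g t))"
      unfolding y_def using m pos[of t] by (intro psi_convex_comb subgrad_nonneg) auto
    also have "\<dots> \<le> q t"
      unfolding q_def using m pos[of t] by (intro add_mono mult_left_mono psi_subgrad_le) auto
    finally show ?thesis .
  qed
  then have "(\<integral>\<^sup>+t. ennreal (psi (y t)) * ?w t \<partial>lborel) \<le> (\<integral>\<^sup>+t. ennreal (q t) * ?w t \<partial>lborel)"
    by (intro nn_integral_mono mult_right_mono ennreal_leI) auto
  then have norm: "(\<integral>\<^sup>+t. ennreal (g t * y t) * ?w t \<partial>lborel) \<le> orlicz_norm \<phi> \<omega> x"
    using q_int by (intro orlicz_norm_ge[OF w y_anti y_pos] x g) auto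
  \<comment> \<open>The only losses are replacing k by \<open>r * k\<close> in front of the first
    subgradient term and \<phi>(k g) <= \<phi>(r k g) in the second; both are absorbed in the factor
    r.\<close>
  have young_eq: "q t + \<phi> (k * g t) \<le> r * k * (g t * y t)" for t
  proof -
    have "k * g t * subgrad (k * g t) \<le> r * k * g t * subgrad (k * g t)"
      by (rule mult_right_mono[OF pos(3)[of t] subgrad_nonneg[OF pos(1)[of t]]])
    then have 1: "young_gap (k * g t) + \<phi> (k * g t) \<le> r * k * g t * subgrad (k * g t)"
      by (simp add: young_gap_def)
    have 2: "young_gap (r * k * g t) + \<phi> (k * g t) \<le> r * k * g t * subgrad (r * k * g t)"
      using phi_mono[of "k * g t" "r * k * g t"] pos[of t] by (simp add: young_gap_def)
    have "q t + \<phi> (k * g t) = (1 - m) * (young_gap (k * g t) + \<phi> (k * g t)) + m * (young_gap (r * k * g t) + \<phi> (k * g t))"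
      by (simp add: q_def algebra_simps)
    also have "\<dots> \<le> (1 - m) * (r * k * g t * subgrad (k * g t)) + m * (r * k * g t * subgrad (r * k * g t))"
      using 1 2 m by (intro add_mono mult_left_mono) auto
    also have "\<dots> = r * k * (g t * y t)" by (simp add: y_def algebra_simps)
    finally show ?thesis .
  qed
  have q_nn: "0 \<le> q t" for t using m young_gap_nonneg by (simp add: q_def)
  have ym: "y \<in> borel_measurable borel" "q \<in> borel_measurable borel"
    unfolding y_def[abs_def] q_def[abs_def] by measurable
  note [measurable] = ym
  have "1 + (\<integral>\<^sup>+t. ennreal (\<phi> (k * g t)) * ?w t \<partial>lborel)
    = (\<integral>\<^sup>+t. ennreal (q t) * ?w t + ennreal (\<phi> (k * g t)) * ?w t \<partial>lborel)"
    using q_int by (simp add: nn_integral_add)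
  also have "\<dots> \<le> (\<integral>\<^sup>+t. ennreal (r * k) * (ennreal (g t * y t) * ?w t) \<partial>lborel)"
  proof (rule nn_integral_mono)
    fix t
    have "ennreal (q t + \<phi> (k * g t)) \<le> ennreal (r * k * (g t * y t))"
      by (rule ennreal_leI[OF young_eq])
    then have "(ennreal (q t) + ennreal (\<phi> (k * g t))) * ?w t \<le> ennreal (r * k) * ennreal (g t * y t) * ?w t"
      using q_nn[of t] g(2)[of t] y_pos[of t] k_pos r
      by (intro mult_right_mono) (simp_all add: ennreal_plus ennreal_mult)
    then show "ennreal (q t) * ?w t + ennreal (\<phi> (k * g t)) * ?w t \<le> ennreal (r * k) * (ennreal (g t * y t) * ?w t)"
      by (simp add: distrib_right mult.assoc)
  qed
  also have "\<dots> = ennreal (r * k) * (\<integral>\<^sup>+t. ennreal (g t * y t) * ?w t \<partial>lborel)"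
    by (rule nn_integral_cmult) measurable
  also have "\<dots> \<le> ennreal (r * k) * orlicz_norm \<phi> \<omega> x"
    by (intro mult_left_mono norm) simp
  finally show ?thesis using k_pos by blast
qed

end

context orlicz
begin

lemma lorentz_finite_imp_rearrangement_finite:
  assumes w: "weight_function \<omega>" "\<And>t. 0 < t \<Longrightarrow> 0 < \<omega> t"
    and x: "x \<in> borel_measurable borel" and c: "0 < c" and fin: "lorentz \<omega> (\<lambda>s. \<phi> (c * x s)) < \<infinity>"
    and t: "0 < t"
  shows "rearrangement x t \<noteq> top"
proof
  note [measurable] = borel_measurable_weight_density[OF w(1)] x
  assume top: "rearrangement x t = top"
  have big: "rearrangement (\<lambda>s. \<phi> (c * x s)) s = top" if "s \<le> t" for s
  proof -
    have "rearrangement x s = top"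
      using antimonoD[OF antimono_rearrangement that, of x] top by (simp add: top_unique)
    then show ?thesis
      using c by (simp add: rearrangement_phi rearrangement_cmult ennreal_mult_top orlicz_ext_def)
  qed
  have "top = top * (\<integral>\<^sup>+s. weight_density \<omega> s * indicator {..t} s \<partial>lborel)"
    using weight_initial_pos[OF w(1) t] w(2)[OF t] by (simp add: ennreal_top_mult)
  also have "\<dots> = (\<integral>\<^sup>+s. top * (weight_density \<omega> s * indicator {..t} s) \<partial>lborel)"
    by (simp add: nn_integral_cmult)
  also have "\<dots> \<le> lorentz \<omega> (\<lambda>s. \<phi> (c * x s))"
    unfolding lorentz_def by (intro nn_integral_mono) (auto simp: indicator_def big)
  finally show False using fin by (simp add: top_unique)
qed

text \<open>\<open>amemiya_bounded\<close> is applied to truncations of x* with factors r tending to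
  1. The multipliers obtained stay in a compact interval, and Fatou's lemma along a convergent
  subsequence gives the claim for the limit.\<close>

lemma amemiya_attained:
  assumes w: "weight_function \<omega>" "\<And>t. 0 < t \<Longrightarrow> 0 < \<omega> t"
    and x: "x \<in> borel_measurable borel"
    and fin: "\<And>t. 0 < t \<Longrightarrow> rearrangement x t \<noteq> top"
    and norm: "orlicz_norm \<phi> \<omega> x = 1"
  shows "\<exists>k>0. 1 + lorentz \<omega> (\<lambda>s. \<phi> (k * x s)) \<le> ennreal k"
proof -
  let ?w = "weight_density \<omega>"
  note [measurable] = borel_measurable_weight_density[OF w(1)] x
  \<comment> \<open>Truncation in height at n and in support to t < n, which supplies both
    boundedness and bounded support.\<close>
  define g where "g n t = enn2real (min (rearrangement x t) (of_nat n)) * indicator {..<real n} t" for n :: nat and t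
  have g_anti: "antimono (g n)" for n
  proof (rule antimonoI)
    fix s t :: real assume "s \<le> t"
    then have "rearrangement x t \<le> rearrangement x s"
      by (rule antimonoD[OF antimono_rearrangement])
    then have "min (rearrangement x t) (of_nat n) \<le> min (rearrangement x s) (of_nat n)"
      by (rule min.mono) simp
    then have "enn2real (min (rearrangement x t) (of_nat n)) \<le> enn2real (min (rearrangement x s) (of_nat n))"
      by (rule enn2real_mono) (simp add: min_less_iff_disj of_nat_less_top)
    with \<open>s \<le> t\<close> show "g n t \<le> g n s"
      by (auto simp: g_def indicator_def)
  qed
  have g_nn: "0 \<le> g n t" for n t by (simp add: g_def)
  have g_le: "g n t \<le> real n" for n t
  proof -
    have "enn2real (min (rearrangement x t) (of_nat n)) \<le> enn2real (of_nat n)"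
      by (rule enn2real_mono) (auto simp: of_nat_less_top)
    then show ?thesis by (auto simp: g_def indicator_def)
  qed
  have g_0: "g n t = 0" if "real n \<le> t" for n t using that by (simp add: g_def)
  have g_x: "ennreal (g n t) \<le> rearrangement x t" for n t
  proof -
    have "min (rearrangement x t) (of_nat n) < top"
      by (simp add: min_less_iff_disj of_nat_less_top)
    then show ?thesis
      by (auto simp: g_def indicator_def min.coboundedI1)
  qed
  have gm [measurable]: "g n \<in> borel_measurable borel" for n
    unfolding g_def[abs_def] by measurable
  have "\<exists>t>0. rearrangement x t \<noteq> 0"
  proof (rule ccontr)
    assume "\<not> ?thesis"
    then have z: "rearrangement x t * rearrangement y t * ?w t = 0" for y t
      by (cases "0 < t") (auto simp: weight_density_def)
    then have "orlicz_norm \<phi> \<omega> x \<le> 0"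
      unfolding orlicz_norm_eq by (intro SUP_least) (simp only: z, simp)
    with norm show False by simp
  qed
  then obtain t0 where t0: "0 < t0" "rearrangement x t0 \<noteq> 0" by blast
  \<comment> \<open>Capping at 1 keeps \<delta> below the truncation height n >= 1, so one lower
    bound on the initial interval up to \<open>t0\<close> serves all large n.\<close>
  define \<delta> where "\<delta> = enn2real (min (rearrangement x t0) 1)"
  have \<delta>: "0 < \<delta>" using t0(2)
    by (simp add: \<delta>_def enn2real_positive_iff min_less_iff_disj zero_less_iff_neq_zero)
  obtain n0 :: nat where n0: "1 \<le> n0" "t0 < real n0"
    using reals_Archimedean2[of "max t0 1"] by (metis less_imp_le max_less_iff_conj of_nat_1 of_nat_le_iff)
  have g_low: "\<delta> \<le> g n t" if "n0 \<le> n" "t \<le> t0" for n t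
  proof -
    have "rearrangement x t0 \<le> rearrangement x t"
      by (rule antimonoD[OF antimono_rearrangement that(2)])
    moreover have "(1 :: ennreal) \<le> of_nat n"
      using n0 that by (metis of_nat_1 of_nat_mono order_trans)
    ultimately have "min (rearrangement x t0) 1 \<le> min (rearrangement x t) (of_nat n)"
      by (rule min.mono)
    then have "\<delta> \<le> enn2real (min (rearrangement x t) (of_nat n))"
      unfolding \<delta>_def by (rule enn2real_mono) (simp add: min_less_iff_disj of_nat_less_top)
    moreover have "t < real n" using n0 that by linarith
    ultimately show ?thesis by (simp add: g_def)
  qed
  define r where "r n = 1 + 1 / real (Suc n)" for n :: nat
  have r: "1 < r n" "r n \<le> 2" for n by (auto simp: r_def)
  have "\<exists>k>0. 1 + (\<integral>\<^sup>+t. ennreal (\<phi> (k * g (n0 + n) t)) * ?w t \<partial>lborel)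
      \<le> ennreal (r n * k) * orlicz_norm \<phi> \<omega> x" for n
    using w(2)[OF t0(1)]
    by (intro amemiya_bounded[OF w(1) g_anti g_nn g_le g_0 t0(1) _ \<delta> g_low r(1) g_x]) auto
  then have "\<exists>k>0. 1 + (\<integral>\<^sup>+t. ennreal (\<phi> (k * g (n0 + n) t)) * ?w t \<partial>lborel) \<le> ennreal (r n * k)" for n
    by (simp add: norm)
  then obtain k where k: "\<And>n. 0 < k n"
    "\<And>n. 1 + (\<integral>\<^sup>+t. ennreal (\<phi> (k n * g (n0 + n) t)) * ?w t \<partial>lborel) \<le> ennreal (r n * k n)"
    by metis
  have k_ge: "1 \<le> r n * k n" for n
  proof -
    have "1 \<le> ennreal (r n * k n)" using k(2)[of n] by (rule order_trans[rotated]) simp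
    then show ?thesis by simp
  qed
  obtain A where A: "0 < A" "(\<integral>\<^sup>+t. ?w t * indicator {..t0} t \<partial>lborel) = ennreal A"
    using weight_locally_finite[OF w(1), of t0] weight_initial_pos[OF w(1) t0(1)] w(2)[OF t0(1)]
    by (cases "\<integral>\<^sup>+t. ?w t * indicator {..t0} t \<partial>lborel") auto
  \<comment> \<open>If \<open>k n\<close> \<delta> >= U, the modular would be at least 3
    \<open>k n\<close>, while \<open>k(2)\<close> and \<open>r n\<close> <= 2 bound it by 2
    \<open>k n\<close>. Hence the multipliers are bounded above.\<close>
  obtain U where U: "0 < U" "\<And>u. U \<le> u \<Longrightarrow> 3 / (\<delta> * A) * u \<le> \<phi> u"
    using phi_superlinear by blast
  have k_le: "k n \<le> U / \<delta>" for n
  proof (rule ccontr)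
    assume "\<not> ?thesis"
    then have "U \<le> k n * \<delta>" using \<delta> by (simp add: field_simps)
    then have "3 / (\<delta> * A) * (k n * \<delta>) \<le> \<phi> (k n * \<delta>)" by (rule U(2))
    then have "3 * k n \<le> \<phi> (k n * \<delta>) * A" using \<delta> A by (simp add: field_simps)
    then have "ennreal (3 * k n) \<le> ennreal (\<phi> (k n * \<delta>)) * ennreal A"
      using A by (simp add: ennreal_leI flip: ennreal_mult)
    also have "\<dots> = (\<integral>\<^sup>+t. ennreal (\<phi> (k n * \<delta>)) * (?w t * indicator {..t0} t) \<partial>lborel)"
      using A by (simp add: nn_integral_cmult)
    also have "\<dots> \<le> (\<integral>\<^sup>+t. ennreal (\<phi> (k n * g (n0 + n) t)) * ?w t \<partial>lborel)"
    proof (rule nn_integral_mono)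
      fix t
      show "ennreal (\<phi> (k n * \<delta>)) * (?w t * indicator {..t0} t) \<le> ennreal (\<phi> (k n * g (n0 + n) t)) * ?w t"
        using g_low[of "n0 + n" t] k(1)[of n] \<delta>
        by (cases "t \<le> t0") (auto intro!: mult_right_mono ennreal_leI phi_mono mult_left_mono)
    qed
    also have "\<dots> \<le> 1 + (\<integral>\<^sup>+t. ennreal (\<phi> (k n * g (n0 + n) t)) * ?w t \<partial>lborel)" by simp
    also have "\<dots> \<le> ennreal (r n * k n)" by (rule k(2))
    also have "\<dots> \<le> ennreal (2 * k n)"
      using r[of n] k(1)[of n] by (intro ennreal_leI mult_right_mono) auto
    finally show False using k(1)[of n] by simp
  qed
  have "k n \<in> {1/2..U / \<delta>}" for n
  proof -
    have "r n * k n \<le> 2 * k n" using r[of n] k(1)[of n] by (intro mult_right_mono) auto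
    then show ?thesis using k_le[of n] k_ge[of n] by auto
  qed
  then obtain l s where l: "l \<in> {1/2..U / \<delta>}" and s: "strict_mono s" and lim: "(k \<circ> s) \<longlonglongrightarrow> l"
    using seq_compactE[OF compact_imp_seq_compact[OF compact_Icc]] by metis
  have l_pos: "0 < l" using l by auto
  have "r \<longlonglongrightarrow> 1 + 0"
    unfolding r_def[abs_def] by (intro tendsto_add tendsto_const LIMSEQ_Suc lim_1_over_n)
  then have rlim: "(r \<circ> s) \<longlonglongrightarrow> 1" using LIMSEQ_subseq_LIMSEQ[OF _ s] by simp
  have rk: "(\<lambda>n. r (s n) * k (s n)) \<longlonglongrightarrow> l"
    using tendsto_mult[OF rlim lim] by (simp add: o_def)
  have conv: "(\<lambda>n. ennreal (\<phi> (k (s n) * g (n0 + s n) t)) * ?w t) \<longlonglongrightarrow>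
    rearrangement (\<lambda>u. \<phi> (l * x u)) t * ?w t" for t
  proof (cases "0 < t")
    case True
    obtain v where v: "0 \<le> v" "rearrangement x t = ennreal v"
      using fin[OF True] by (cases "rearrangement x t") auto
    obtain N :: nat where N: "v < real N" "t < real N"
      using reals_Archimedean2[of "max v t"] by auto
    have "g (n0 + s n) t = v" if "N \<le> n" for n
    proof -
      have "N \<le> n0 + s n" using seq_suble[OF s, of n] that by linarith
      then have n: "v \<le> real (n0 + s n)" "t < real (n0 + s n)" using N by (auto simp del: of_nat_add)
      have "ennreal v \<le> of_nat (n0 + s n)"
        using n(1) v by (metis ennreal_leI ennreal_of_nat_eq_real_of_nat)
      then show ?thesis using n v by (simp add: g_def min_absorb1)
    qed
    \<comment> \<open>At a fixed t > 0 the truncation is eventually inactive because the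
      rearrangement is finite there; only the multipliers still vary.\<close>
    then have "eventually (\<lambda>n. v = g (n0 + s n) t) sequentially"
      unfolding eventually_sequentially by metis
    then have "(\<lambda>n. g (n0 + s n) t) \<longlonglongrightarrow> v"
      by (rule Lim_transform_eventually[OF tendsto_const])
    then have "(\<lambda>n. k (s n) * g (n0 + s n) t) \<longlonglongrightarrow> l * v"
      using tendsto_mult[OF lim] by (simp add: o_def)
    moreover have "isCont \<phi> (l * v)"
      using continuous_phi[of UNIV] by (simp add: continuous_on_eq_continuous_at)
    ultimately have "(\<lambda>n. \<phi> (k (s n) * g (n0 + s n) t)) \<longlonglongrightarrow> \<phi> (l * v)"
      by (rule isCont_tendsto_compose[rotated])
    then have "(\<lambda>n. ennreal (\<phi> (k (s n) * g (n0 + s n) t))) \<longlonglongrightarrow> ennreal (\<phi> (l * v))"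
      by (rule tendsto_ennrealI)
    moreover have "?w t \<noteq> top" by (simp add: weight_density_def indicator_def)
    ultimately have "(\<lambda>n. ennreal (\<phi> (k (s n) * g (n0 + s n) t)) * ?w t) \<longlonglongrightarrow> ennreal (\<phi> (l * v)) * ?w t"
      by (intro tendsto_mult_ennreal tendsto_const) auto
    moreover have "rearrangement (\<lambda>u. \<phi> (l * x u)) t = ennreal (\<phi> (l * v))"
      using l_pos v by (simp add: rearrangement_phi rearrangement_cmult orlicz_ext_def flip: ennreal_mult)
    ultimately show ?thesis by simp
  qed (simp add: weight_density_def)
  have "lorentz \<omega> (\<lambda>u. \<phi> (l * x u)) =
    (\<integral>\<^sup>+t. liminf (\<lambda>n. ennreal (\<phi> (k (s n) * g (n0 + s n) t)) * ?w t) \<partial>lborel)"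
    unfolding lorentz_def
    by (intro nn_integral_cong lim_imp_Liminf[symmetric] conv) simp
  also have "\<dots> \<le> liminf (\<lambda>n. (\<integral>\<^sup>+t. ennreal (\<phi> (k (s n) * g (n0 + s n) t)) * ?w t \<partial>lborel))"
    by (intro nn_integral_liminf) measurable
  also have "\<dots> \<le> liminf (\<lambda>n. ennreal (r (s n) * k (s n) - 1))"
  proof (intro Liminf_mono always_eventually allI)
    fix n
    have "(\<integral>\<^sup>+t. ennreal (\<phi> (k (s n) * g (n0 + s n) t)) * ?w t \<partial>lborel) \<le> ennreal (r (s n) * k (s n)) - 1"
      using ennreal_minus_mono[OF k(2)[of "s n"] order_refl[of 1]] by (simp add: ennreal_add_diff_cancel_left)
    then show "(\<integral>\<^sup>+t. ennreal (\<phi> (k (s n) * g (n0 + s n) t)) * ?w t \<partial>lborel) \<le> ennreal (r (s n) * k (s n) - 1)"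
      by (simp add: ennreal_minus flip: ennreal_1)
  qed
  also have "\<dots> = ennreal (l - 1)"
    by (intro lim_imp_Liminf tendsto_ennrealI tendsto_diff rk tendsto_const) simp
  finally have "1 + lorentz \<omega> (\<lambda>u. \<phi> (l * x u)) \<le> 1 + ennreal (l - 1)"
    by (rule add_left_mono)
  also have "\<dots> = ennreal l"
  proof -
    \<comment> \<open>Needed because \<open>ennreal\<close> cuts negative numbers off at 0, so 1 +
      \<open>ennreal (l - 1)\<close> is \<open>ennreal l\<close> only for l >= 1.\<close>
    have "1 \<le> l" using k_ge by (intro tendsto_lowerbound[OF rk]) auto
    then show ?thesis by (simp flip: ennreal_1 ennreal_plus)
  qed
  finally show ?thesis using l_pos by blast
qed

end

section \<open>Non-squareness\<close>

context orlicz
begin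

text \<open>For one of the signs the argument has absolute value equal to the distance of a|u| and
  b|v|, hence at most the larger of the two. \<open>phi_scale_less\<close> then makes \<phi> there
  strictly smaller than the right-hand side.\<close>

lemma zero_if_both_signs_extremal:
  assumes a: "0 < a" "0 < b" "a + b = 1"
    and plus: "\<phi> (a * u + b * v) = a * \<phi> u + b * \<phi> v"
    and minus: "\<phi> (a * u - b * v) = a * \<phi> u + b * \<phi> v"
  shows "u = 0"
proof (rule ccontr)
  assume u: "u \<noteq> 0"
  have "\<bar>a * \<bar>u\<bar> - b * \<bar>v\<bar>\<bar> = \<bar>a * u + b * v\<bar> \<or> \<bar>a * \<bar>u\<bar> - b * \<bar>v\<bar>\<bar> = \<bar>a * u - b * v\<bar>"
    by (auto simp: abs_real_def algebra_simps)
  then have eq: "\<phi> \<bar>a * \<bar>u\<bar> - b * \<bar>v\<bar>\<bar> = a * \<phi> u + b * \<phi> v"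
    using plus minus by (metis phi_abs)
  have pos: "0 \<le> a * \<bar>u\<bar>" "0 \<le> b * \<bar>v\<bar>" "0 \<le> a * \<phi> u" "0 \<le> b * \<phi> v" using a by auto
  show False
  proof (cases "b * \<bar>v\<bar> \<le> a * \<bar>u\<bar>")
    case True
    have "\<phi> \<bar>a * \<bar>u\<bar> - b * \<bar>v\<bar>\<bar> \<le> \<phi> (a * \<bar>u\<bar>)"
      using True pos by (intro phi_mono) auto
    also have "\<dots> < a * \<phi> \<bar>u\<bar>"
      using a u by (intro phi_scale_less) auto
    finally show False using eq pos by simp
  next
    case False
    then have "v \<noteq> 0" using pos by auto
    have "\<phi> \<bar>a * \<bar>u\<bar> - b * \<bar>v\<bar>\<bar> \<le> \<phi> (b * \<bar>v\<bar>)"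
      using False pos by (intro phi_mono) auto
    also have "\<dots> < b * \<phi> \<bar>v\<bar>"
      using a \<open>v \<noteq> 0\<close> by (intro phi_scale_less) auto
    finally show False using eq pos by simp
  qed
qed

lemma orlicz_norm_AE_zero:
  assumes x: "x \<in> borel_measurable borel" and 0: "AE s in lborel. 0 \<le> s \<longrightarrow> x s = 0"
  shows "orlicz_norm \<phi> \<omega> x = 0"
proof -
  note [measurable] = x
  have "distribution_fun x 0 = emeasure lborel ({} :: real set)"
    unfolding distribution_fun_borel[OF x]
    by (rule emeasure_eq_AE) (use 0 in \<open>auto elim: eventually_mono\<close>)
  then have "rearrangement x t = 0" for t
    using rearrangement_le_iff[OF x, of 0 t] by simp
  then show ?thesis
    unfolding orlicz_norm_eq by (intro antisym SUP_least) auto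
qed

lemma midpoints_norm_less:
  assumes w: "weight_function \<omega>" and inf: "(\<integral>\<^sup>+t. weight_density \<omega> t \<partial>lborel) = \<infinity>"
    and x: "x \<in> borel_measurable borel" "\<And>t. 0 < t \<Longrightarrow> rearrangement x t \<noteq> top" "orlicz_norm \<phi> \<omega> x = 1"
    and y: "y \<in> borel_measurable borel" "\<And>t. 0 < t \<Longrightarrow> rearrangement y t \<noteq> top" "orlicz_norm \<phi> \<omega> y = 1"
  shows "orlicz_norm \<phi> \<omega> (\<lambda>s. (x s - y s) / 2) < 1 \<or> orlicz_norm \<phi> \<omega> (\<lambda>s. (x s + y s) / 2) < 1"
proof (rule ccontr)
  assume "\<not> ?thesis"
  \<comment> \<open>The sign is written as a factor 1 or -1 so that both midpoints are handled by
    the single fact \<open>eq\<close> below.\<close>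
  then have minus: "1 \<le> orlicz_norm \<phi> \<omega> (\<lambda>s. (x s + (- 1) * y s) / 2)"
    and plus: "1 \<le> orlicz_norm \<phi> \<omega> (\<lambda>s. (x s + 1 * y s) / 2)" by auto
  note [measurable] = x(1) y(1)
  note pos = weight_positive[OF w inf]
  obtain k where k: "0 < k" "1 + lorentz \<omega> (\<lambda>s. \<phi> (k * x s)) \<le> ennreal k"
    using amemiya_attained[OF w pos x] by blast
  obtain l where l: "0 < l" "1 + lorentz \<omega> (\<lambda>s. \<phi> (l * y s)) \<le> ennreal l"
    using amemiya_attained[OF w pos y] by blast
  define a b d where "a = l / (k + l)" and "b = k / (k + l)" and "d = k * l / (k + l)"
  define c where "c = 2 * d"
  have a: "0 < a" "0 < b" "0 < c" using k l by (auto simp: a_def b_def c_def d_def)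
  have ak: "a * k = d" "b * l = d" by (simp_all add: a_def b_def d_def mult.commute)
  have "k + l \<noteq> 0" using k l by simp
  then have "a + b = 1"
    unfolding a_def b_def add_divide_distrib[symmetric] by (simp add: add.commute)
  moreover have "a * k + b * l = c" unfolding ak c_def by simp
  ultimately have ab: "a + b = 1" "a * k + b * l = c" .
  \<comment> \<open>The common convexity bound for both signs; evenness of \<phi> makes it
    independent of the sign.\<close>
  define h where "h s = a * \<phi> (k * x s) + b * \<phi> (l * y s)" for s
  have hm [measurable]: "h \<in> borel_measurable borel" unfolding h_def[abs_def] by measurable
  have ab1: "ennreal a + ennreal b = 1" using a ab by (simp flip: ennreal_plus)
  have "1 + lorentz \<omega> h \<le> 1 + (ennreal a * lorentz \<omega> (\<lambda>s. \<phi> (k * x s)) + ennreal b * lorentz \<omega> (\<lambda>s. \<phi> (l * y s)))"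
    unfolding h_def[abs_def] using lorentz_add[OF w, of "\<lambda>s. a * \<phi> (k * x s)" "\<lambda>s. b * \<phi> (l * y s)"] a
    by (simp add: lorentz_cmult[OF w] add_left_mono)
  also have "\<dots> = (ennreal a + ennreal b) + (ennreal a * lorentz \<omega> (\<lambda>s. \<phi> (k * x s)) + ennreal b * lorentz \<omega> (\<lambda>s. \<phi> (l * y s)))"
    unfolding ab1 ..
  also have "\<dots> = ennreal a * (1 + lorentz \<omega> (\<lambda>s. \<phi> (k * x s))) + ennreal b * (1 + lorentz \<omega> (\<lambda>s. \<phi> (l * y s)))"
    by (simp add: distrib_left ac_simps)
  also have "\<dots> \<le> ennreal a * ennreal k + ennreal b * ennreal l"
    using k l by (intro add_mono mult_left_mono) auto
  also have "\<dots> = ennreal c"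
    using a k l ab by (simp flip: ennreal_mult ennreal_plus)
  finally have hc: "1 + lorentz \<omega> h \<le> ennreal c" .
  have h_fin: "lorentz \<omega> h < \<infinity>"
  proof -
    have "lorentz \<omega> h \<le> 1 + lorentz \<omega> h" by simp
    also have "\<dots> < \<infinity>" using hc by (rule le_less_trans) simp
    finally show ?thesis .
  qed
  have eq: "AE s in lborel. 0 \<le> s \<longrightarrow> \<phi> (a * (k * x s) + e * (b * (l * y s))) = h s"
    if e: "e = 1 \<or> e = - 1" and ge: "1 \<le> orlicz_norm \<phi> \<omega> (\<lambda>s. (x s + e * y s) / 2)" for e
  proof -
    define f where "f s = \<phi> (a * (k * x s) + e * (b * (l * y s)))" for s
    have fm [measurable]: "f \<in> borel_measurable borel" unfolding f_def[abs_def] by measurable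
    have mid: "c * ((x s + e * y s) / 2) = a * (k * x s) + e * (b * (l * y s))" for s
    proof -
      have mid: "c * ((x s + e * y s) / 2) = d * x s + e * (d * y s)" by (simp add: c_def algebra_simps)
      then show ?thesis by (simp only: mult.assoc[symmetric] ak)
    qed
    have "(\<lambda>s. (x s + e * y s) / 2) \<in> borel_measurable borel" by measurable
    \<comment> \<open>Multiplier c in the Amemiya bound turns norm >= 1 into c <= 1 +
      \<open>lorentz \<omega> f\<close>. With \<open>hc\<close> this gives equal functionals for the
      ordered pair f <= h, which is the case covered by strict monotonicity.\<close>
    from order_trans[OF ge orlicz_norm_le[OF w this a(3)]]
    have "1 \<le> ennreal (1 / c) * (1 + lorentz \<omega> f)"
      unfolding mid f_def[abs_def] .
    then have "ennreal c * 1 \<le> ennreal c * (ennreal (1 / c) * (1 + lorentz \<omega> f))"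
      by (rule mult_left_mono) simp
    also have "\<dots> = 1 + lorentz \<omega> f"
      using a by (simp add: mult.assoc[symmetric] flip: ennreal_mult)
    finally have "ennreal c \<le> 1 + lorentz \<omega> f" by simp
    then have "1 + lorentz \<omega> h \<le> 1 + lorentz \<omega> f" by (rule order_trans[OF hc])
    then have "lorentz \<omega> h \<le> lorentz \<omega> f" by (simp add: ennreal_add_left_cancel_le)
    moreover have fh: "\<bar>f s\<bar> \<le> \<bar>h s\<bar>" for s
    proof -
      have "f s \<le> a * \<phi> (k * x s) + b * \<phi> (e * (l * y s))"
        unfolding f_def using phi_convex_comb[of a b "k * x s" "e * (l * y s)"] a ab
        by (simp add: mult.left_commute)
      also have "\<dots> = h s" using e by (auto simp: h_def)
      finally show ?thesis by (simp add: f_def)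
    qed
    ultimately have "AE s in lborel. 0 \<le> s \<longrightarrow> \<bar>f s\<bar> = \<bar>h s\<bar>"
      using lorentz_eq_imp_AE_eq[OF w inf fm hm fh h_fin] by blast
    moreover have "\<bar>f s\<bar> = f s" "\<bar>h s\<bar> = h s" for s using a by (auto simp: f_def h_def)
    ultimately show ?thesis unfolding f_def by simp
  qed
  have "AE s in lborel. 0 \<le> s \<longrightarrow> \<phi> (a * (k * x s) + b * (l * y s)) = h s"
    using eq[OF _ plus] by simp
  moreover have "AE s in lborel. 0 \<le> s \<longrightarrow> \<phi> (a * (k * x s) - b * (l * y s)) = h s"
    using eq[OF _ minus] by simp
  ultimately have "AE s in lborel. 0 \<le> s \<longrightarrow> x s = 0"
  proof eventually_elim
    case (elim s)
    then show ?case
      using zero_if_both_signs_extremal[of a b "k * x s" "l * y s"] a ab k by (auto simp: h_def)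
  qed
  then have "orlicz_norm \<phi> \<omega> x = 0" by (rule orlicz_norm_AE_zero[OF x(1)])
  with x(3) show False by simp
qed

end

section \<open>Passage to Borel representatives\<close>

lemma ex_borel_representative:
  fixes x :: "real \<Rightarrow> real"
  assumes "x \<in> borel_measurable (lebesgue_on {0..})"
  shows "\<exists>x'\<in>borel_measurable borel. AE s in lebesgue_on {0..}. x s = x' s"
proof -
  have "(\<lambda>s. indicator {0..} s *\<^sub>R x s) \<in> borel_measurable lebesgue"
    using assms by (subst (asm) borel_measurable_restrict_space_iff) auto
  from completion_ex_borel_measurable_real[OF this]
  obtain x' where x': "x' \<in> borel_measurable lborel" "AE s in lborel. indicator {0..} s *\<^sub>R x s = x' s"
    by blast
  from AE_completion[OF x'(2)] have "AE s in lebesgue. s \<in> {0..} \<longrightarrow> x s = x' s"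
    by eventually_elim auto
  then have "AE s in lebesgue_on {0..}. x s = x' s"
    by (subst AE_restrict_space_iff) auto
  with x'(1) show ?thesis by auto
qed

lemma orlicz_norm_cong_AE:
  assumes "x \<in> borel_measurable (lebesgue_on {0..})" "y \<in> borel_measurable (lebesgue_on {0..})"
    and "AE s in lebesgue_on {0..}. x s = y s"
  shows "orlicz_norm \<phi> \<omega> x = orlicz_norm \<phi> \<omega> y"
  unfolding orlicz_norm_def rearrangement_cong_AE[OF assms] ..

text \<open>Norms depend only on classes, so Borel representatives can be put into
  \<open>midpoints_norm_less\<close>; membership in the space makes their rearrangements finite at
  every t > 0.\<close>

lemma (in orlicz) non_square_if_infinite_weight:
  assumes w: "weight_function \<omega>" and inf: "(\<integral>\<^sup>+t. weight_density \<omega> t \<partial>lborel) = \<infinity>"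
  shows "non_square (orlicz_lorentz_space \<phi> \<omega>) (orlicz_norm \<phi> \<omega>)"
proof -
  have rep: "\<exists>x'\<in>borel_measurable borel. (AE s in lebesgue_on {0..}. x s = x' s) \<and>
      (\<forall>t>0. rearrangement x' t \<noteq> top) \<and> orlicz_norm \<phi> \<omega> x' = 1"
    if x: "x \<in> orlicz_lorentz_space \<phi> \<omega>" "orlicz_norm \<phi> \<omega> x = 1" for x
  proof -
    have xm [measurable]: "x \<in> borel_measurable (lebesgue_on {0..})"
      using x by (simp add: orlicz_lorentz_space_def)
    obtain c where c: "0 < c" "modular \<phi> \<omega> (\<lambda>s. c * x s) < \<infinity>"
      using x by (auto simp: orlicz_lorentz_space_def)
    obtain x' where x': "x' \<in> borel_measurable borel" "AE s in lebesgue_on {0..}. x s = x' s"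
      using ex_borel_representative[OF xm] by blast
    have x'm [measurable]: "x' \<in> borel_measurable (lebesgue_on {0..})"
      using x'(1) by (intro measurable_restrict_space1 measurable_completion) simp
    have "rearrangement (\<lambda>s. c * x s) = rearrangement (\<lambda>s. c * x' s)"
      by (rule rearrangement_cong_AE) (use x'(2) in \<open>auto elim: eventually_mono\<close>)
    then have "modular \<phi> \<omega> (\<lambda>s. c * x' s) < \<infinity>" using c by (simp add: modular_def)
    then have "lorentz \<omega> (\<lambda>s. \<phi> (c * x' s)) < \<infinity>"
      using x'(1) by (subst (asm) modular_eq_lorentz) auto
    then have "\<forall>t>0. rearrangement x' t \<noteq> top"
      using lorentz_finite_imp_rearrangement_finite[OF w weight_positive[OF w inf] x'(1) c(1)] by blast
    moreover have "orlicz_norm \<phi> \<omega> x' = 1"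
      using orlicz_norm_cong_AE[OF xm x'm x'(2)] x(2) by simp
    ultimately show ?thesis using x' by blast
  qed
  show ?thesis
    unfolding non_square_def
  proof (intro ballI)
    fix x y
    assume "x \<in> {x \<in> orlicz_lorentz_space \<phi> \<omega>. orlicz_norm \<phi> \<omega> x = 1}"
      and "y \<in> {x \<in> orlicz_lorentz_space \<phi> \<omega>. orlicz_norm \<phi> \<omega> x = 1}"
    then have xy: "x \<in> orlicz_lorentz_space \<phi> \<omega>" "orlicz_norm \<phi> \<omega> x = 1"
      "y \<in> orlicz_lorentz_space \<phi> \<omega>" "orlicz_norm \<phi> \<omega> y = 1" by auto
    have [measurable]: "x \<in> borel_measurable (lebesgue_on {0..})" "y \<in> borel_measurable (lebesgue_on {0..})"
      using xy by (auto simp: orlicz_lorentz_space_def)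
    obtain x' where x': "x' \<in> borel_measurable borel" "AE s in lebesgue_on {0..}. x s = x' s"
      "\<forall>t>0. rearrangement x' t \<noteq> top" "orlicz_norm \<phi> \<omega> x' = 1"
      using rep[OF xy(1,2)] by blast
    obtain y' where y': "y' \<in> borel_measurable borel" "AE s in lebesgue_on {0..}. y s = y' s"
      "\<forall>t>0. rearrangement y' t \<noteq> top" "orlicz_norm \<phi> \<omega> y' = 1"
      using rep[OF xy(3,4)] by blast
    have [measurable]: "x' \<in> borel_measurable (lebesgue_on {0..})" "y' \<in> borel_measurable (lebesgue_on {0..})"
      using x'(1) y'(1) by (auto intro!: measurable_restrict_space1 measurable_completion)
    have "AE s in lebesgue_on {0..}. (x s - y s) / 2 = (x' s - y' s) / 2"
      using x'(2) y'(2) by eventually_elim simp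
    then have "orlicz_norm \<phi> \<omega> (\<lambda>s. (x s - y s) / 2) = orlicz_norm \<phi> \<omega> (\<lambda>s. (x' s - y' s) / 2)"
      by (rule orlicz_norm_cong_AE[rotated 2]) measurable
    moreover have "AE s in lebesgue_on {0..}. (x s + y s) / 2 = (x' s + y' s) / 2"
      using x'(2) y'(2) by eventually_elim simp
    then have "orlicz_norm \<phi> \<omega> (\<lambda>s. (x s + y s) / 2) = orlicz_norm \<phi> \<omega> (\<lambda>s. (x' s + y' s) / 2)"
      by (rule orlicz_norm_cong_AE[rotated 2]) measurable
    ultimately show "min (orlicz_norm \<phi> \<omega> (\<lambda>s. (x s - y s) / 2)) (orlicz_norm \<phi> \<omega> (\<lambda>s. (x s + y s) / 2)) < 1"
      using midpoints_norm_less[OF w inf x'(1) _ x'(4) y'(1) _ y'(4)] x'(3) y'(3)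
      by (auto simp: min_less_iff_disj)
  qed
qed

section \<open>Failure of non-squareness for finite total weight\<close>

lemma rearrangement_two_valued:
  assumes x: "x \<in> borel_measurable borel" and c: "0 < c"
    and vals: "\<And>s. 0 \<le> s \<Longrightarrow> \<bar>x s\<bar> \<le> c" and inf: "emeasure lborel {s. 0 \<le> s \<and> \<bar>x s\<bar> = c} = \<infinity>"
  shows "rearrangement x t = ennreal c"
proof (rule ennreal_eqI_le)
  fix \<theta> :: real assume \<theta>: "0 \<le> \<theta>"
  note [measurable] = x
  show "rearrangement x t \<le> ennreal \<theta> \<longleftrightarrow> ennreal c \<le> ennreal \<theta>"
  \<comment> \<open>From c upwards the level sets are empty; below c they have infinite measure,
    which no finite t dominates.\<close>
  proof (cases "c \<le> \<theta>")
    case True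
    then have "{s. 0 \<le> s \<and> \<theta> < \<bar>x s\<bar>} = {}" using vals by fastforce
    then have "distribution_fun x \<theta> = 0"
      by (simp only: distribution_fun_borel[OF x] emeasure_empty)
    then show ?thesis
      unfolding rearrangement_le_iff[OF x \<theta>] using True \<theta> by simp
  next
    case False
    then have "emeasure lborel {s. 0 \<le> s \<and> \<bar>x s\<bar> = c} \<le> emeasure lborel {s. 0 \<le> s \<and> \<theta> < \<bar>x s\<bar>}"
      by (intro emeasure_mono) auto
    then show ?thesis
      unfolding rearrangement_le_iff[OF x \<theta>] distribution_fun_borel[OF x]
      using inf False \<theta> c by (simp add: top_unique)
  qed
qed

text \<open>Translation by 1 carries the even set onto the odd one, so their measures agree;
  together they fill the half line, whose measure is infinite.\<close>

lemma emeasure_even_floor: "emeasure lborel {s::real. 0 \<le> s \<and> even \<lfloor>s\<rfloor>} = \<infinity>" (is "emeasure _ ?E = _")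
  and emeasure_odd_floor: "emeasure lborel {s::real. 0 \<le> s \<and> odd \<lfloor>s\<rfloor>} = \<infinity>" (is "emeasure _ ?O = _")
proof -
  have [measurable]: "?E \<in> sets borel" "?O \<in> sets borel" by measurable
  have shift: "(+) (- 1) -` ?E = ?O"
  proof -
    have "even \<lfloor>- 1 + s\<rfloor> \<longleftrightarrow> odd \<lfloor>s\<rfloor>" for s :: real
    proof -
      have "\<lfloor>- 1 + s\<rfloor> = \<lfloor>s\<rfloor> - 1" by linarith
      then show ?thesis by simp
    qed
    \<comment> \<open>An odd floor excludes [0,1), so shifting back by 1 stays in the half
      line.\<close>
    moreover have "1 \<le> s" if "0 \<le> s" "odd \<lfloor>s\<rfloor>" for s :: real
    proof (rule ccontr)
      assume "\<not> ?thesis"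
      then have "\<lfloor>s\<rfloor> = 0" using that by linarith
      with that show False by simp
    qed
    ultimately show ?thesis by auto
  qed
  have "emeasure lborel ?E = emeasure (distr lborel borel ((+) (- 1))) ?E"
    by (subst lborel_distr_plus) simp
  also have "\<dots> = emeasure lborel ?O"
    using emeasure_distr[of "(+) (- 1)" lborel borel ?E] unfolding shift by simp
  finally have eq: "emeasure lborel ?E = emeasure lborel ?O" .
  have "emeasure lborel ?E + emeasure lborel ?O = emeasure lborel (?E \<union> ?O)"
    by (rule plus_emeasure) auto
  also have "?E \<union> ?O = {\<theta>. 0 \<le> \<theta> \<and> ennreal \<theta> < top}" by (auto simp: ennreal_less_top)
  finally have "emeasure lborel ?E + emeasure lborel ?O = top"
    by (simp only: emeasure_below_ennreal)
  with eq show "emeasure lborel ?E = \<infinity>" "emeasure lborel ?O = \<infinity>" by auto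
qed

lemma orlicz_norm_cmult:
  assumes w: "weight_function \<omega>" and x: "x \<in> borel_measurable borel" and c: "0 < c"
  shows "orlicz_norm \<phi> \<omega> (\<lambda>s. c * x s) = ennreal c * orlicz_norm \<phi> \<omega> x"
proof -
  note [measurable] = borel_measurable_weight_density[OF w]
  show ?thesis
    unfolding orlicz_norm_eq
    by (simp add: rearrangement_cmult[OF x c] SUP_mult_left_ennreal mult.assoc nn_integral_cmult)
qed

lemma (in orlicz) not_non_square_if_finite_weight:
  assumes w: "weight_function \<omega>" and fin: "(\<integral>\<^sup>+t. weight_density \<omega> t \<partial>lborel) < \<infinity>"
    and t: "0 < t" "\<omega> t \<noteq> 0"
  shows "\<not> non_square (orlicz_lorentz_space \<phi> \<omega>) (orlicz_norm \<phi> \<omega>)"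
proof -
  note [measurable] = borel_measurable_weight_density[OF w]
  have "(\<integral>\<^sup>+s. weight_density \<omega> s * indicator {..t} s \<partial>lborel) \<le> (\<integral>\<^sup>+s. weight_density \<omega> s \<partial>lborel)"
    by (intro nn_integral_mono) (auto simp: indicator_def)
  with weight_initial_pos[OF w t] have "0 < (\<integral>\<^sup>+s. weight_density \<omega> s \<partial>lborel)"
    by (rule less_le_trans)
  with fin obtain W where W: "0 < W" "(\<integral>\<^sup>+s. weight_density \<omega> s \<partial>lborel) = ennreal W"
    by (cases "\<integral>\<^sup>+s. weight_density \<omega> s \<partial>lborel") auto
  have flat: "rearrangement x s = ennreal c"
    if "x \<in> borel_measurable borel" "0 < c" "\<And>s. \<bar>x s\<bar> \<le> c"
      "(\<forall>s. even \<lfloor>s\<rfloor> \<longrightarrow> \<bar>x s\<bar> = c) \<or> (\<forall>s. odd \<lfloor>s\<rfloor> \<longrightarrow> \<bar>x s\<bar> = c)" for x c s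
  proof (rule rearrangement_two_valued)
    note [measurable] = that(1)
    have B: "{s. 0 \<le> s \<and> \<bar>x s\<bar> = c} \<in> sets borel" by measurable
    have large: "emeasure lborel {s. 0 \<le> s \<and> \<bar>x s\<bar> = c} = \<infinity>"
      if "A \<subseteq> {s. 0 \<le> s \<and> \<bar>x s\<bar> = c}" "emeasure lborel A = \<infinity>" for A
      using emeasure_mono[OF that(1), of lborel] B that(2) by (simp add: top_unique)
    from that(4) show "emeasure lborel {s. 0 \<le> s \<and> \<bar>x s\<bar> = c} = \<infinity>"
    proof
      assume "\<forall>s. even \<lfloor>s\<rfloor> \<longrightarrow> \<bar>x s\<bar> = c"
      then show ?thesis by (intro large[OF _ emeasure_even_floor]) auto
    next
      assume "\<forall>s. odd \<lfloor>s\<rfloor> \<longrightarrow> \<bar>x s\<bar> = c"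
      then show ?thesis by (intro large[OF _ emeasure_odd_floor]) auto
    qed
  qed (use that in auto)
  have const: "rearrangement (\<lambda>_. c) s = ennreal c" if "0 < c" for c s
    using that by (intro flat) auto
  define \<nu> where "\<nu> = orlicz_norm \<phi> \<omega> (\<lambda>_. 1)"
  \<comment> \<open>With multiplier 1 the bound is 1 + \<phi>(1) W, finite because the total weight
    W is.\<close>
  have "\<nu> \<le> ennreal (1 / 1) * (1 + lorentz \<omega> (\<lambda>s. \<phi> (1 * 1)))"
    unfolding \<nu>_def by (intro orlicz_norm_le w) auto
  also have "\<dots> < top"
    using phi_pos[of 1] W
    by (simp add: lorentz_def const nn_integral_cmult ennreal_mult_less_top)
  finally have nu_fin: "\<nu> < top" .
  \<comment> \<open>The constant e is an admissible test function: \<psi>(e) <= e \<psi>(1) by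
    convexity, so \<psi>(e) W <= 1. It bounds the norm of the constant 1 below by e W > 0.\<close>
  define e where "e = min 1 (1 / (psi 1 * W + 1))"
  have den: "0 < psi 1 * W + 1" using W psi_nonneg[of 1] by (simp add: add_nonneg_pos)
  have e: "0 < e" "e \<le> 1" "e * (psi 1 * W) \<le> 1"
  proof -
    show "0 < e" "e \<le> 1" using den by (auto simp: e_def)
    have "e * (psi 1 * W) \<le> 1 / (psi 1 * W + 1) * (psi 1 * W)"
      using W psi_nonneg[of 1] by (intro mult_right_mono) (auto simp: e_def)
    also have "\<dots> \<le> 1" using den by (simp add: field_simps)
    finally show "e * (psi 1 * W) \<le> 1" .
  qed
  have "psi e \<le> e * psi 1"
    using psi_convex_comb[of e "1 - e" 1 0] e by simp
  then have "psi e * W \<le> e * psi 1 * W"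
    using W by (intro mult_right_mono) auto
  then have "psi e * W \<le> 1"
    using e by (simp add: mult.assoc)
  then have "(\<integral>\<^sup>+t. ennreal (psi e) * weight_density \<omega> t \<partial>lborel) \<le> 1"
    using W psi_nonneg[of e] by (simp add: nn_integral_cmult flip: ennreal_mult)
  then have "(\<integral>\<^sup>+t. ennreal (1 * e) * weight_density \<omega> t \<partial>lborel) \<le> \<nu>"
    unfolding \<nu>_def using e const[of 1] by (intro orlicz_norm_ge w) (auto intro: antimonoI)
  then have "ennreal (e * W) \<le> \<nu>"
    using W e by (simp add: nn_integral_cmult ennreal_mult)
  moreover have "0 < ennreal (e * W)" using e W by simp
  ultimately have nu_pos: "0 < \<nu>" by (rule less_le_trans[rotated])
  obtain n where n: "0 < n" "\<nu> = ennreal n"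
    using nu_fin nu_pos by (cases \<nu>) auto
  define c where "c = 1 / n"
  have c: "0 < c" using n by (simp add: c_def)
  have "orlicz_norm \<phi> \<omega> (\<lambda>_. c * 1) = ennreal c * \<nu>"
    unfolding \<nu>_def by (rule orlicz_norm_cmult[OF w]) (use c in auto)
  also have "\<dots> = 1" using n by (simp add: c_def flip: ennreal_mult)
  finally have norm_const: "orlicz_norm \<phi> \<omega> (\<lambda>_. c) = 1" by simp
  have norm: "orlicz_norm \<phi> \<omega> x = 1" if "\<And>s. rearrangement x s = ennreal c" for x
    using norm_const unfolding orlicz_norm_eq by (simp add: that const[OF c])
  have space: "x \<in> orlicz_lorentz_space \<phi> \<omega>"
    if x: "x \<in> borel_measurable borel" and r: "\<And>s. rearrangement x s = ennreal c" for x
  proof -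
    have "modular \<phi> \<omega> (\<lambda>s. 1 * x s) < \<infinity>"
      unfolding modular_def set_nn_integral_weight using W c
      by (simp add: r orlicz_ext_def nn_integral_cmult ennreal_mult_less_top)
    moreover have "x \<in> borel_measurable (lebesgue_on {0..})"
      using x by (intro measurable_restrict_space1 measurable_completion) simp
    ultimately show ?thesis
      unfolding orlicz_lorentz_space_def by (auto intro!: exI[of _ 1])
  qed
  \<comment> \<open>The half-difference from the constant c vanishes where the floor is even and
    equals c where it is odd, and the half-sum does the reverse. All these functions are bounded by
    c and reach it on a set of infinite measure.\<close>
  define y where "y s = (if even \<lfloor>s\<rfloor> then c else - c)" for s :: real
  have ym [measurable]: "y \<in> borel_measurable borel" unfolding y_def[abs_def] by measurable
  have ry: "rearrangement y s = ennreal c" for s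
    using c by (intro flat) (auto simp: y_def)
  have rm: "rearrangement (\<lambda>s. (c - y s) / 2) s = ennreal c" for s
    using c by (intro flat) (auto simp: y_def)
  have rp: "rearrangement (\<lambda>s. (c + y s) / 2) s = ennreal c" for s
    using c by (intro flat) (auto simp: y_def)
  show ?thesis
  proof
    assume "non_square (orlicz_lorentz_space \<phi> \<omega>) (orlicz_norm \<phi> \<omega>)"
    then have "min (orlicz_norm \<phi> \<omega> (\<lambda>s. (c - y s) / 2)) (orlicz_norm \<phi> \<omega> (\<lambda>s. (c + y s) / 2)) < 1"
      unfolding non_square_def using norm[OF ry] norm_const space[OF ym ry] space[OF _ const[OF c]] by simp
    then show False using norm[OF rm] norm[OF rp] by simp
  qed
qed

theorem theorem3p1:
  fixes \<phi> \<omega> :: "real \<Rightarrow> real"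
  assumes "orlicz_function \<phi>"
    and "weight_function \<omega>"
    and "\<exists>t>0. \<omega> t \<noteq> 0"
  shows "non_square (orlicz_lorentz_space \<phi> \<omega>) (orlicz_norm \<phi> \<omega>)
         \<longleftrightarrow> (\<integral>\<^sup>+t\<in>{0..}. ennreal (\<omega> t) \<partial>lebesgue) = \<infinity>"
proof -
  interpret orlicz \<phi> by unfold_locales (rule assms(1))
  have eq: "(\<integral>\<^sup>+t\<in>{0..}. ennreal (\<omega> t) \<partial>lebesgue) = (\<integral>\<^sup>+t. weight_density \<omega> t \<partial>lborel)"
    using set_nn_integral_weight[of "\<lambda>_. 1" \<omega>] by simp
  show ?thesis
    unfolding eq using non_square_if_infinite_weight[OF assms(2)]
      not_non_square_if_finite_weight[OF assms(2)] assms(3)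
    by (metis infinity_ennreal_def less_top)
qed

end
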